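(* Let $r \geq 2$ be an even integer and let $y$ be a random variable uniformly distributed on the range of $T_r$, which is $\left[0,\frac{r^2}{2r^2-2}\right]$. Then the expected number of local level sets contained in $L_r(y)$ is given by $$\mathbb{E}\big[N_r^{loc}(y)\big] = \frac{2r^2-2}{r^2}\int_0^{\frac{r^2}{2r^2-2}} N_r^{loc}(y)\,dy = 1+\frac{1}{r}.$$ Here $N_r^{loc}(y)$ is the number of local level sets contained in $L_r(y)$.
   Context: Let $r\ge 2$ be an even integer. The Takagi-van der Waerden function is $T_r(x)=\sum_{n=0}^\infty \frac{\phi(r^n x)}{r^n}$ for $x\in[0,1]$, where $\phi(x)=\mathrm{dist}(x,\mathbb{Z})$ is the distance from $x$ to the nearest integer. For $y\in\mathbb{R}$ the level set is $L_r(y)=\{x\in[0,1]: T_r(x)=y\}$. Each $x\in(0,1)$ has an $r$-based expansion $x=0.\varepsilon_1\varepsilon_2\cdots=\sum_{k\ge1}\varepsilon_k r^{-k}$ with $\varepsilon_k\in\{0,1,\dots,r-1\}$; if $x$ has two expansions, the one ending in zeros is used. For $n\in\mathbb{Z}^+$ (the positive integers) put $$D_{r,n}(x)=\mathrm{card}\{1\le j\le n:\varepsilon_j<r/2\}-\mathrm{card}\{1\le j\le n:\varepsilon_j\ge r/2\}.$$ For $x=0.\varepsilon_1\varepsilon_2\dots$ and $x'=0.\eta_1\eta_2\dots$ in $(0,1)$, write $x\sim_r x'$ if for every $j\in\mathbb{Z}^+$: (i) $|D_{r,j}(x)|=|D_{r,j}(x')|$; and (ii) if $|D_{r,j}(x)|>0$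 then $\varepsilon_j=\eta_j$ or $\varepsilon_j+\eta_j=r-1$. This is an equivalence relation on $(0,1)$. The local level set of $x\in(0,1)$ is $L_{r,x}^{loc}=\{x'\in(0,1): x'\sim_r x\}$. $N_r^{loc}(y)$ is the number (possibly infinite) of distinct sets of the form $L_{r,x}^{loc}$, $x\in(0,1)$, that are contained in $L_r(y)$. *)

theory Defs
  imports "HOL-Probability.Probability"
begin

definition Takagi :: "nat \<Rightarrow> real \<Rightarrow> real" where
  "Takagi r x = (\<Sum>n. infdist (real r ^ n * x) \<int> / real r ^ n)"

definition level_set :: "nat \<Rightarrow> real \<Rightarrow> real set" where
  "level_set r y = {x \<in> {0..1}. Takagi r x = y}"

text \<open>Expansions are indexed from 0: \<open>e k\<close> is the coefficient of \<open>r\<close> to the power \<open>- (k + 1)\<close>.\<close>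

definition is_expansion :: "nat \<Rightarrow> real \<Rightarrow> (nat \<Rightarrow> nat) \<Rightarrow> bool" where
  "is_expansion r x e \<longleftrightarrow>
     (\<forall>k. e k < r) \<and> (\<lambda>k. real (e k) / real r ^ Suc k) sums x"

definition expansion :: "nat \<Rightarrow> real \<Rightarrow> nat \<Rightarrow> nat" where
  "expansion r x = (THE e. is_expansion r x e \<and>
     ((\<exists>e'. is_expansion r x e' \<and> e' \<noteq> e) \<longrightarrow> (\<forall>\<^sub>F k in sequentially. e k = 0)))"

text \<open>The digit \<open>digit r x j\<close> is numbered from \<open>j = 1\<close>; its value at \<open>j = 0\<close> is never used.\<close>

definition digit :: "nat \<Rightarrow> real \<Rightarrow> nat \<Rightarrow> nat" where
  "digit r x j = expansion r x (j - 1)"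

definition digit_diff :: "nat \<Rightarrow> nat \<Rightarrow> real \<Rightarrow> int" where
  "digit_diff r n x = int (card {j \<in> {1..n}. real (digit r x j) < real r / 2})
     - int (card {j \<in> {1..n}. real (digit r x j) \<ge> real r / 2})"

text \<open>The condition \<open>\<epsilon> + \<eta> = r - 1\<close> is written without truncated subtraction.\<close>

definition loc_equiv :: "nat \<Rightarrow> real \<Rightarrow> real \<Rightarrow> bool" where
  "loc_equiv r x x' \<longleftrightarrow> (\<forall>j\<ge>1.
     \<bar>digit_diff r j x\<bar> = \<bar>digit_diff r j x'\<bar> \<and>
     (\<bar>digit_diff r j x\<bar> > 0 \<longrightarrow> digit r x j = digit r x' j \<or> digit r x j + digit r x' j + 1 = r))"

definition local_level_set :: "nat \<Rightarrow> real \<Rightarrow> real set" where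
  "local_level_set r x = {x' \<in> {0<..<1}. loc_equiv r x' x}"

definition N_loc :: "nat \<Rightarrow> real \<Rightarrow> ennreal" where
  "N_loc r y = emeasure (count_space UNIV)
     {L. L \<subseteq> level_set r y \<and> (\<exists>x\<in>{0<..<1}. L = local_level_set r x)}"

lemma summable_digits:
  fixes e :: "nat \<Rightarrow> nat"
  assumes r: "r \<ge> 2" and e: "\<And>k. e k < r"
  shows "summable (\<lambda>k. real (e k) / real r ^ Suc k)"
    and "(\<Sum>k. real (e k) / real r ^ Suc k) \<le> 1"
proof -
  have g: "(\<lambda>k. (1 / real r) ^ k) sums (1 / (1 - 1 / real r))"
    using r by (intro geometric_sums) auto
  have "(\<lambda>k. (real r - 1) / real r * (1 / real r) ^ k) sums
      ((real r - 1) / real r * (1 / (1 - 1 / real r)))"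
    by (rule sums_mult[OF g])
  also have "(real r - 1) / real r * (1 / (1 - 1 / real r)) = 1"
    using r by (simp add: field_simps)
  finally have s: "(\<lambda>k. (real r - 1) / real r * (1 / real r) ^ k) sums 1" .
  have le: "real (e k) / real r ^ Suc k \<le> (real r - 1) / real r * (1 / real r) ^ k" for k
  proof -
    have "real (e k) \<le> real r - 1" using e[of k] by linarith
    then show ?thesis using r by (simp add: power_divide divide_right_mono)
  qed
  show sm: "summable (\<lambda>k. real (e k) / real r ^ Suc k)"
    by (rule summable_comparison_test'[OF sums_summable[OF s], of 0]) (use le in auto)
  show "(\<Sum>k. real (e k) / real r ^ Suc k) \<le> 1"
    using suminf_le[OF le sm sums_summable[OF s]] sums_unique[OF s] by simp
qed

text \<open>The definite description in \<open>expansion\<close> is well defined.\<close>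

lemma ex1_expansion:
  assumes r: "r \<ge> 2" and x: "0 < x" "x < 1"
  shows "\<exists>!e. is_expansion r x e \<and>
    ((\<exists>e'. is_expansion r x e' \<and> e' \<noteq> e) \<longrightarrow> (\<forall>\<^sub>F k in sequentially. e k = 0))"
proof -
  let ?ev = "\<lambda>e::nat \<Rightarrow> nat. \<forall>\<^sub>F k in sequentially. e k = 0"
  define t where "t e n = (\<Sum>k. real (e (k + n)) / real r ^ Suc k)" for e :: "nat \<Rightarrow> nat" and n
  have t_le: "t e n \<le> 1" and t_ge: "t e n \<ge> 0"
    and t_step: "real (e n) + t e (Suc n) = real r * t e n"
    if "\<And>k. e k < r" for e n
  proof -
    have sm: "summable (\<lambda>k. real (e (k + m)) / real r ^ Suc k)" for m
      using summable_digits(1)[OF r, of "\<lambda>k. e (k + m)"] that by simp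
    show "t e n \<le> 1" using summable_digits(2)[OF r, of "\<lambda>k. e (k + n)"] that by (simp add: t_def)
    show "t e n \<ge> 0" unfolding t_def by (intro suminf_nonneg sm) simp
    have "t e n = (\<Sum>k. real (e (k + Suc n)) / real r ^ Suc (Suc k)) + real (e n) / real r"
      unfolding t_def using suminf_split_head[OF sm[of n]] by simp
    also have "(\<Sum>k. real (e (k + Suc n)) / real r ^ Suc (Suc k)) =
        (\<Sum>k. (real (e (k + Suc n)) / real r ^ Suc k) / real r)"
      by (simp add: mult.commute)
    also have "\<dots> = t e (Suc n) / real r"
      unfolding t_def by (rule suminf_divide[OF sm])
    finally show "real (e n) + t e (Suc n) = real r * t e n"
      using r by (simp add: field_simps)
  qed
  have key: "?ev a"
    if ea: "is_expansion r x a" and eb: "is_expansion r x b"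
      and n: "\<And>m. m < n \<Longrightarrow> a m = b m" "b n < a n" for a b n
  proof -
    have da: "a k < r" and db: "b k < r" for k using ea eb by (auto simp: is_expansion_def)
    have "m \<le> n \<Longrightarrow> t a m = t b m" for m
    proof (induction m)
      case 0
      show ?case using ea eb unfolding t_def is_expansion_def by (simp add: sums_iff)
    next
      case (Suc m)
      then show ?case
        using t_step[of a m, OF da] t_step[of b m, OF db] n(1)[of m] by simp
    qed
    then have "real (a n) + t a (Suc n) = real (b n) + t b (Suc n)"
      using t_step[of a n, OF da] t_step[of b n, OF db] by simp
    moreover have "real (b n) + 1 \<le> real (a n)" using n(2) by linarith
    ultimately have 0: "t a (Suc n) = 0"
      using t_le[of b "Suc n", OF db] t_ge[of a "Suc n", OF da] by linarith
    have tz: "t a (Suc n + k) = 0" for k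
    proof (induction k)
      case (Suc k)
      then show ?case
        using t_step[of a "Suc n + k", OF da] t_ge[of a "Suc (Suc n + k)", OF da] by simp
    qed (use 0 in simp)
    have "a (Suc n + k) = 0" for k
      using t_step[of a "Suc n + k", OF da] tz[of k] tz[of "Suc k"] by simp
    then show ?thesis
      unfolding eventually_sequentially by (intro exI[of _ "Suc n"]) (auto simp: le_iff_add)
  qed
  have nkey: "\<not> ?ev b"
    if ea: "is_expansion r x a" and eb: "is_expansion r x b"
      and n: "\<And>m. m < n \<Longrightarrow> a m = b m" "b n < a n" for a b n
  proof
    assume "?ev b"
    then obtain M where M: "\<And>k. k \<ge> M \<Longrightarrow> b k = 0" by (auto simp: eventually_sequentially)
    have da: "a k < r" and db: "b k < r" for k using ea eb by (auto simp: is_expansion_def)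
    have "m \<le> n \<Longrightarrow> t a m = t b m" for m
    proof (induction m)
      case 0
      show ?case using ea eb unfolding t_def is_expansion_def by (simp add: sums_iff)
    next
      case (Suc m)
      then show ?case
        using t_step[of a m, OF da] t_step[of b m, OF db] n(1)[of m] by simp
    qed
    then have "real (a n) + t a (Suc n) = real (b n) + t b (Suc n)"
      using t_step[of a n, OF da] t_step[of b n, OF db] by simp
    moreover have "real (b n) + 1 \<le> real (a n)" using n(2) by linarith
    ultimately have 1: "t b (Suc n) = 1"
      using t_le[of b "Suc n", OF db] t_ge[of a "Suc n", OF da] by linarith
    have br: "real (b k) \<le> real r - 1" for k using db[of k] by linarith
    have "t b (Suc n + k) = 1" for k
    proof (induction k)
      case (Suc k)
      then show ?case
        using t_step[of b "Suc n + k", OF db] t_le[of b "Suc (Suc n + k)", OF db] br[of "Suc n + k"]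
        by simp
    qed (use 1 in simp)
    from this[of M] have "t b (Suc n + M) = 1" .
    moreover have "t b (Suc n + M) = 0" unfolding t_def by (simp add: M)
    ultimately show False by simp
  qed
  define e0 where "e0 k = nat (\<lfloor>real r ^ Suc k * x\<rfloor> mod int r)" for k
  have ps: "(\<Sum>k<n. real (e0 k) / real r ^ Suc k) = real_of_int \<lfloor>real r ^ n * x\<rfloor> / real r ^ n" for n
  proof (induction n)
    case 0
    have "\<lfloor>x\<rfloor> = 0" using x by linarith
    then show ?case by simp
  next
    case (Suc n)
    have "\<lfloor>real r ^ Suc n * x / real r\<rfloor> = \<lfloor>real r ^ Suc n * x\<rfloor> div int r"
      using floor_divide_real_eq_div[of "int r" "real r ^ Suc n * x"] by simp
    moreover have "real r ^ Suc n * x / real r = real r ^ n * x" using r by simp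
    ultimately have "\<lfloor>real r ^ n * x\<rfloor> = \<lfloor>real r ^ Suc n * x\<rfloor> div int r" by simp
    then have "\<lfloor>real r ^ Suc n * x\<rfloor> = int r * \<lfloor>real r ^ n * x\<rfloor> + int (e0 n)"
      using r by (simp add: e0_def)
    then have "real_of_int \<lfloor>real r ^ Suc n * x\<rfloor> = real r * real_of_int \<lfloor>real r ^ n * x\<rfloor> + real (e0 n)"
      by (simp only: of_int_add of_int_mult of_int_of_nat_eq)
    then show ?case using Suc r by (simp add: field_simps)
  qed
  have "(\<lambda>n. real_of_int \<lfloor>real r ^ n * x\<rfloor> / real r ^ n) \<longlonglongrightarrow> x"
  proof (rule tendsto_sandwich[of "\<lambda>n. x - (1 / real r) ^ n" _ _ "\<lambda>n. x"])
    show "\<forall>\<^sub>F n in sequentially. x - (1 / real r) ^ n \<le> real_of_int \<lfloor>real r ^ n * x\<rfloor> / real r ^ n"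
    proof (intro always_eventually allI)
      fix n
      have "real r ^ n * x - 1 \<le> real_of_int \<lfloor>real r ^ n * x\<rfloor>" by linarith
      then have "(real r ^ n * x - 1) / real r ^ n \<le> real_of_int \<lfloor>real r ^ n * x\<rfloor> / real r ^ n"
        by (rule divide_right_mono) simp
      moreover have "(real r ^ n * x - 1) / real r ^ n = x - (1 / real r) ^ n"
        using r by (simp add: diff_divide_distrib power_divide)
      ultimately show "x - (1 / real r) ^ n \<le> real_of_int \<lfloor>real r ^ n * x\<rfloor> / real r ^ n"
        by simp
    qed
    show "\<forall>\<^sub>F n in sequentially. real_of_int \<lfloor>real r ^ n * x\<rfloor> / real r ^ n \<le> x"
    proof (intro always_eventually allI)
      fix n
      have "real_of_int \<lfloor>real r ^ n * x\<rfloor> \<le> real r ^ n * x" by linarith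
      then show "real_of_int \<lfloor>real r ^ n * x\<rfloor> / real r ^ n \<le> x"
        using r by (simp add: field_simps)
    qed
    have "(\<lambda>n. (1 / real r) ^ n) \<longlonglongrightarrow> 0" using r by (intro LIMSEQ_power_zero) simp
    then show "(\<lambda>n. x - (1 / real r) ^ n) \<longlonglongrightarrow> x"
      using tendsto_diff[of "\<lambda>_. x" x sequentially "\<lambda>n. (1 / real r) ^ n" 0] by simp
  qed simp
  then have e0: "is_expansion r x e0"
    unfolding is_expansion_def sums_def ps using r by (simp add: e0_def nat_less_iff)
  have trich: "(?ev a \<and> \<not> ?ev b) \<or> (?ev b \<and> \<not> ?ev a)"
    if "is_expansion r x a" "is_expansion r x b" "a \<noteq> b" for a b
  proof -
    define n where "n = (LEAST n. a n \<noteq> b n)"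
    have "\<exists>n. a n \<noteq> b n" using that(3) by auto
    then have "a n \<noteq> b n" unfolding n_def by (rule LeastI_ex)
    moreover have "m < n \<Longrightarrow> a m = b m" for m unfolding n_def using not_less_Least by blast
    ultimately consider "b n < a n" "\<And>m. m < n \<Longrightarrow> a m = b m"
      | "a n < b n" "\<And>m. m < n \<Longrightarrow> b m = a m"
      by (metis linorder_neqE_nat)
    then show ?thesis
    proof cases
      case 1
      then show ?thesis
        using key[OF that(1,2) 1(2,1)] nkey[OF that(1,2) 1(2,1)] by simp
    next
      case 2
      then show ?thesis
        using key[OF that(2,1) 2(2,1)] nkey[OF that(2,1) 2(2,1)] by simp
    qed
  qed
  let ?Q = "\<lambda>e. is_expansion r x e \<and>
    ((\<exists>e'. is_expansion r x e' \<and> e' \<noteq> e) \<longrightarrow> ?ev e)"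
  have uniq: "a = b" if "?Q a" "?Q b" for a b
  proof (rule ccontr)
    assume ne: "a \<noteq> b"
    then have "?ev a" "?ev b" using that by blast+
    then show False using trich[of a b] that ne by simp
  qed
  have "\<exists>e. ?Q e"
  proof (cases "\<exists>e'. is_expansion r x e' \<and> e' \<noteq> e0")
    case True
    then obtain e' where e': "is_expansion r x e'" "e' \<noteq> e0" by blast
    from trich[OF e'(1) e0 e'(2)] show ?thesis
    proof
      assume "?ev e' \<and> \<not> ?ev e0"
      then show ?thesis using e'(1) by (intro exI[of _ e']) simp
    next
      assume "?ev e0 \<and> \<not> ?ev e'"
      then show ?thesis using e0 by (intro exI[of _ e0]) simp
    qed
  next
    case False
    then have "?Q e0" using e0 by blast
    then show ?thesis by (rule exI[of ?Q e0])
  qed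
  then obtain e where "?Q e" by (rule exE)
  then show ?thesis
    by (rule ex1I[of ?Q e]) (rule uniq[OF _ \<open>?Q e\<close>])
qed

end

theory Submission
  imports Defs
begin

text \<open>
  Write \<open>T\<close> for the Takagi-van der Waerden function. The partial sums of its series are piecewise
  affine, and near \<open>x\<close> the slope after \<open>n\<close> terms is the digit difference of \<open>x\<close>. Reading
  the digits of \<open>x\<close> therefore produces a walk of slopes with steps plus and minus 1, and \<open>T\<close> over an
  \<open>r\<close>-adic interval on which the walk has reached \<open>k\<close> is a copy, scaled by \<open>1 / r ^ n\<close>, of
  \<open>k x + T x\<close> over the unit interval (\<open>shear_digit\<close>).

  A local level set arises from one point by reflecting excursions of the walk and by changing the
  digits with which the walk returns to 0; neither changes \<open>T\<close> (\<open>shear_reflected\<close>). Each local level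
  set thus has exactly one member whose walk is nonnegative and which returns to 0 only by the digit
  \<open>r / 2\<close>. Except at the level 0, the number of local level sets in a level set is the number of
  such canonical digit sequences at that level (\<open>N_loc_eq_crossings\<close>).

  These sequences are counted by their first \<open>n\<close> digits. A prefix whose walk ends at \<open>k\<close>
  contributes to a set of levels of measure \<open>M k / r ^ n\<close>, where \<open>M k\<close> is the maximum of \<open>k x + T x\<close>:
  reflection shows that canonical sequences already attain every value, and by continuity the values
  form an interval. The integral of the number of prefixes is thus \<open>P ^ n M\<close> at 0 for the transition
  operator \<open>P\<close> of a walk that is killed at the forbidden digits (\<open>nn_integral_visits\<close>). The function
  \<open>h k = k + 1 / (r - 1)\<close> for \<open>k \<ge> 1\<close>, with \<open>h 0 = r / (2 (r - 1))\<close>, is harmonic for \<open>P\<close> and differs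
  from \<open>M\<close> by at most 1, while \<open>P ^ n 1\<close> tends to 0 since a bounded harmonic function vanishes.
  So the integrals increase to \<open>h 0\<close>, which is by monotone convergence the integral of the number
  of local level sets. Division by the maximum \<open>r ^ 2 / (2 r ^ 2 - 2)\<close> of \<open>T\<close> gives \<open>1 + 1 / r\<close>.
\<close>

section \<open>The Takagi function and its graph under an integer shear\<close>

lemma infdist_Ints: "infdist (t::real) \<int> = \<bar>t - of_int (round t)\<bar>"
proof (rule antisym)
  show "infdist t \<int> \<le> \<bar>t - of_int (round t)\<bar>"
    using infdist_le[of "of_int (round t)" \<int> t] by (simp add: dist_real_def)
  have "\<int> \<noteq> ({}::real set)" using Ints_0 by blast
  then have "infdist t \<int> = (INF a\<in>\<int>. dist t a)" by (simp add: infdist_def)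
  also have "\<dots> \<ge> \<bar>t - of_int (round t)\<bar>"
    using \<open>\<int> \<noteq> {}\<close> round_diff_minimal[of t]
    by (intro cINF_greatest) (auto simp: dist_real_def elim!: Ints_cases)
  finally show "\<bar>t - of_int (round t)\<bar> \<le> infdist t \<int>" .
qed

lemma infdist_Ints_le: "infdist (t::real) \<int> \<le> \<bar>t - of_int m\<bar>"
  unfolding infdist_Ints by (rule round_diff_minimal)

lemma infdist_Ints_le_half: "infdist (t::real) \<int> \<le> 1 / 2"
  unfolding infdist_Ints using of_int_round_abs_le[of t] by (simp add: abs_minus_commute)

lemma infdist_Ints_eqI:
  fixes t :: real
  assumes "\<bar>t - of_int m\<bar> \<le> 1 / 2"
  shows "infdist t \<int> = \<bar>t - of_int m\<bar>"
proof (rule antisym[OF infdist_Ints_le])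
  show "\<bar>t - of_int m\<bar> \<le> infdist t \<int>"
  proof (cases "round t = m")
    case False
    then have "\<bar>real_of_int (round t) - of_int m\<bar> \<ge> 1" by linarith
    then show ?thesis using assms unfolding infdist_Ints by linarith
  qed (simp add: infdist_Ints)
qed

lemma infdist_Ints_lower_half: "0 \<le> t \<Longrightarrow> t \<le> 1 / 2 \<Longrightarrow> infdist (t::real) \<int> = t"
  and infdist_Ints_upper_half: "1 / 2 \<le> t \<Longrightarrow> t \<le> 1 \<Longrightarrow> infdist (t::real) \<int> = 1 - t"
  using infdist_Ints_eqI[of t 0] infdist_Ints_eqI[of t 1] by auto

lemma infdist_Ints_add_int [simp]: "infdist (of_int m + t :: real) \<int> = infdist t \<int>"
proof -
  have "\<bar>of_int m + t - of_int (m + round t)\<bar> \<le> 1/2"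
    using infdist_Ints_le_half[of t] by (simp add: infdist_Ints)
  from infdist_Ints_eqI[OF this] show ?thesis by (simp add: infdist_Ints)
qed

locale even_base =
  fixes r :: nat
  assumes r: "r \<ge> 2" and ev: "even r"
begin

lemma summable_Takagi: "summable (\<lambda>n. infdist (real r ^ n * x) \<int> / real r ^ n)"
  and Takagi_term_le: "norm (infdist (real r ^ n * x) \<int> / real r ^ n) \<le> (1/2) * (1 / real r) ^ n"
  and summable_half_geometric: "summable (\<lambda>n. (1/2) * (1 / real r) ^ n)"
proof -
  show sm: "summable (\<lambda>n. (1/2) * (1 / real r) ^ n)"
    using r by (intro summable_mult summable_geometric) auto
  show le: "norm (infdist (real r ^ n * x) \<int> / real r ^ n) \<le> (1/2) * (1 / real r) ^ n" for n
    using divide_right_mono[OF infdist_Ints_le_half[of "real r ^ n * x"], of "real r ^ n"]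
    by (simp add: infdist_nonneg power_divide)
  show "summable (\<lambda>n. infdist (real r ^ n * x) \<int> / real r ^ n)"
    by (rule summable_comparison_test'[OF sm, of 0]) (use le in auto)
qed

lemma continuous_on_Takagi: "continuous_on A (Takagi r)"
proof -
  have "uniform_limit A (\<lambda>n x. \<Sum>i<n. infdist (real r ^ i * x) \<int> / real r ^ i)
      (\<lambda>x. \<Sum>i. infdist (real r ^ i * x) \<int> / real r ^ i) sequentially"
    using Takagi_term_le summable_half_geometric by (intro Weierstrass_m_test)
  then show ?thesis
    unfolding Takagi_def[abs_def]
    by (rule uniform_limit_theorem[rotated])
       (use r in \<open>auto intro!: always_eventually continuous_intros\<close>)
qed

lemma Takagi_nonneg: "Takagi r x \<ge> 0"
  unfolding Takagi_def by (intro suminf_nonneg summable_Takagi) (simp add: infdist_nonneg)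

lemma Takagi_0 [simp]: "Takagi r 0 = 0"
  by (simp add: Takagi_def)

lemma Takagi_functional_equation:
  "Takagi r ((real d + u) / real r) = infdist ((real d + u) / real r) \<int> + Takagi r u / real r"
proof -
  let ?x = "(real d + u) / real r"
  have "Takagi r ?x =
      (\<Sum>n. infdist (real r ^ Suc n * ?x) \<int> / real r ^ Suc n) + infdist ?x \<int>"
    unfolding Takagi_def using suminf_split_head[OF summable_Takagi[of ?x]] by simp
  also have "(\<lambda>n. infdist (real r ^ Suc n * ?x) \<int> / real r ^ Suc n) =
      (\<lambda>n. (infdist (real r ^ n * u) \<int> / real r ^ n) / real r)"
  proof
    fix n
    have "real r ^ Suc n * ?x = of_int (int r ^ n * int d) + real r ^ n * u"
      using r by (simp add: field_simps)
    then show "infdist (real r ^ Suc n * ?x) \<int> / real r ^ Suc n =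
        (infdist (real r ^ n * u) \<int> / real r ^ n) / real r"
      by (simp only: infdist_Ints_add_int) (simp add: mult.commute)
  qed
  also have "(\<Sum>n. (infdist (real r ^ n * u) \<int> / real r ^ n) / real r) = Takagi r u / real r"
    unfolding Takagi_def by (rule suminf_divide[OF summable_Takagi])
  finally show ?thesis by simp
qed

text \<open>
  If \<open>t\<close> is at distance \<open>s\<close> from the nearest integer, then \<open>r t\<close> is at distance at most
  \<open>r (1 / 2 - s)\<close> from a multiple of \<open>r\<close> plus or minus \<open>r / 2\<close>, which is an integer because
  \<open>r\<close> is even. So two consecutive terms of the series balance each other.
\<close>

lemma infdist_two_scales: "infdist t \<int> + infdist (real r * t) \<int> / real r \<le> 1 / 2"
proof -
  obtain m where m: "r = 2 * m" using ev by (elim evenE)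
  define n where "n = round t"
  define s where "s = t - of_int n"
  have s: "infdist t \<int> = \<bar>s\<bar>" "\<bar>s\<bar> \<le> 1 / 2"
    using infdist_Ints_le_half[of t] by (auto simp: infdist_Ints s_def n_def)
  define p where "p = int r * n + (if s \<ge> 0 then int m else - int m)"
  have "infdist (real r * t) \<int> \<le> \<bar>real r * t - of_int p\<bar>" by (rule infdist_Ints_le)
  also have "real r * t - of_int p = real r * (s - (if s \<ge> 0 then 1 / 2 else - 1 / 2))"
    by (simp add: s_def p_def m algebra_simps)
  also have "\<bar>\<dots>\<bar> = real r * (1 / 2 - \<bar>s\<bar>)"
    using s(2) by (auto simp: abs_mult)
  finally show ?thesis using r s by (simp add: field_simps)
qed

lemma Takagi_le: "Takagi r x \<le> real r ^ 2 / (2 * real r ^ 2 - 2)"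
proof -
  let ?a = "\<lambda>n. infdist (real r ^ n * x) \<int> / real r ^ n"
  have r2: "real r ^ 2 > 1" using r by (simp add: one_less_power)
  have grouped: "(\<lambda>m. sum ?a {m * 2..<m * 2 + 2}) sums Takagi r x"
    using sums_group[OF summable_sums[OF summable_Takagi], of 2] by (simp add: Takagi_def)
  have geometric: "(\<lambda>m. (1/2) * (1 / real r ^ 2) ^ m) sums ((1/2) * (1 / (1 - 1 / real r ^ 2)))"
    using r2 by (intro sums_mult geometric_sums) (simp add: divide_less_eq)
  have le: "sum ?a {m * 2..<m * 2 + 2} \<le> (1/2) * (1 / real r ^ 2) ^ m" for m
  proof -
    let ?t = "real r ^ (m * 2) * x"
    have "sum ?a {m * 2..<m * 2 + 2} = ?a (m * 2) + ?a (Suc (m * 2))"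
      by (simp add: numeral_2_eq_2)
    also have "\<dots> = (infdist ?t \<int> + infdist (real r * ?t) \<int> / real r) / real r ^ (m * 2)"
      using r by (simp add: field_simps)
    also have "\<dots> \<le> (1/2) / real r ^ (m * 2)"
      by (intro divide_right_mono infdist_two_scales) simp
    also have "\<dots> = (1/2) * (1 / real r ^ 2) ^ m"
      unfolding power_divide power_mult[symmetric] mult.commute[of 2 m] by simp
    finally show ?thesis .
  qed
  have "Takagi r x \<le> (1/2) * (1 / (1 - 1 / real r ^ 2))"
    by (rule sums_le[OF le grouped geometric])
  also have "(1/2) * (1 / (1 - 1 / z)) = z / (2 * z - 2)" if "z > 1" for z :: real
  proof -
    have "1 - 1 / z = (z - 1) / z" using that by (simp add: field_simps)
    then show ?thesis using that by (simp add: field_simps)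
  qed
  from this[OF r2] have "(1/2) * (1 / (1 - 1 / real r ^ 2)) = real r ^ 2 / (2 * real r ^ 2 - 2)" .
  finally show ?thesis .
qed

lemma Takagi_le_1: "Takagi r x \<le> 1"
proof -
  have "real r ^ 2 \<ge> 2 ^ 2" using r by (intro power_mono) auto
  then have "real r ^ 2 / (2 * real r ^ 2 - 2) \<le> 1" by (simp add: field_simps)
  with Takagi_le[of x] show ?thesis by linarith
qed

text \<open>
  The point \<open>x = r / (2 (r + 1))\<close> satisfies \<open>r x = r / 2 - x\<close>. Multiplication by \<open>r\<close> thus acts on it
  as \<open>x \<mapsto> - x\<close> modulo 1, all its multiples by powers of \<open>r\<close> are equally far from the integers,
  and the series is geometric.
\<close>

lemma Takagi_attains_max:
  "Takagi r (real r / (2 * (real r + 1))) = real r ^ 2 / (2 * real r ^ 2 - 2)"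
proof -
  let ?x = "real r / (2 * (real r + 1))"
  obtain m where m: "r = 2 * m" using ev by (elim evenE)
  have neg: "infdist (- t) \<int> = infdist t \<int>" for t :: real
    using infdist_Ints_eqI[of "- t" "- round t"] infdist_Ints_le_half[of t]
    by (simp add: infdist_Ints abs_minus_commute)
  have scaled: "infdist (real r ^ n * ?x) \<int> = ?x" for n
  proof (induction n)
    case 0
    have "?x \<ge> 0" "?x \<le> 1 / 2" by (simp_all add: field_simps)
    then show ?case using infdist_Ints_lower_half[of ?x] by simp
  next
    case (Suc n)
    have shift: "real r * ?x = of_int (int m) + - ?x" by (simp add: m field_simps)
    have "real r ^ Suc n * t = real r ^ n * (real r * t)" for t by simp
    then have "real r ^ Suc n * ?x = real r ^ n * (of_int (int m) + - ?x)"
      unfolding shift[symmetric] .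
    also have "\<dots> = of_int (int r ^ n * int m) + - (real r ^ n * ?x)"
      by (simp add: algebra_simps)
    finally have eq: "real r ^ Suc n * ?x = of_int (int r ^ n * int m) + - (real r ^ n * ?x)" .
    show ?case unfolding eq infdist_Ints_add_int neg by (rule Suc)
  qed
  have "Takagi r ?x = (\<Sum>n. ?x * (1 / real r) ^ n)"
    unfolding Takagi_def scaled by (simp add: power_divide)
  also have "(\<lambda>n. ?x * (1 / real r) ^ n) sums (?x * (1 / (1 - 1 / real r)))"
    using r by (intro sums_mult geometric_sums) auto
  then have "(\<Sum>n. ?x * (1 / real r) ^ n) = ?x * (1 / (1 - 1 / real r))"
    by (rule sums_unique[symmetric])
  also have "\<dots> = real r ^ 2 / (2 * real r ^ 2 - 2)"
  proof -
    have "real r - 1 > 0" "real r + 1 > 0" using r by auto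
    moreover have "2 * real r ^ 2 - 2 = 2 * (real r + 1) * (real r - 1)"
      by (simp add: power2_eq_square algebra_simps)
    ultimately show ?thesis using r by (simp add: field_simps power2_eq_square)
  qed
  finally show ?thesis .
qed

text \<open>
  After \<open>n\<close> digits of \<open>x\<close> the partial sum of the series is affine near \<open>x\<close>, with slope the current
  value \<open>k\<close> of the digit difference. Up to a shift and the factor \<open>1 / r ^ n\<close>, the graph over the
  corresponding interval is therefore that of \<open>k x + T x\<close> over the unit interval.
\<close>

definition shear :: "int \<Rightarrow> real \<Rightarrow> real" where
  "shear k x = of_int k * x + Takagi r x"

definition step :: "nat \<Rightarrow> int" where
  "step d = (if 2 * d < r then 1 else - 1)"

definition offset :: "int \<Rightarrow> nat \<Rightarrow> real" where
  "offset k d = of_int (k + step d) * real d + (if 2 * d < r then 0 else real r)"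

text \<open>
  The self-similarity of the sheared graphs. A digit below \<open>r / 2\<close> lies in the rising half of the
  distance function and raises the slope by one, any other digit lowers it by one.
\<close>

lemma shear_digit:
  assumes u: "0 \<le> u" "u \<le> 1" and d: "d < r"
  shows "shear k ((real d + u) / real r) = (offset k d + shear (k + step d) u) / real r"
proof -
  have r0: "real r > 0" using r by simp
  note T = Takagi_functional_equation[of d u]
  show ?thesis
  proof (cases "2 * d < r")
    case True
    then have "2 * d + 2 \<le> r" using ev by presburger
    then have "real (2 * d + 2) \<le> real r" by (simp only: of_nat_le_iff)
    then have "2 * (real d + 1) \<le> real r" by simp
    then have "(real d + u) / real r \<le> 1 / 2" "(real d + u) / real r \<ge> 0"
      using u r0 by (simp_all add: field_simps)
    then have "infdist ((real d + u) / real r) \<int> = (real d + u) / real r"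
      by (intro infdist_Ints_lower_half)
    with True show ?thesis unfolding shear_def T offset_def step_def
      by (simp add: add_divide_distrib distrib_left distrib_right)
  next
    case False
    then have "real (d + 1) \<le> real r" "real r \<le> real (2 * d)"
      using d by (simp_all only: of_nat_le_iff)
    then have "2 * (real d + u) \<ge> real r" "real d + u \<le> real r" using u by simp_all
    then have "(real d + u) / real r \<ge> 1 / 2" "(real d + u) / real r \<le> 1"
      using r0 by (simp_all add: field_simps)
    then have "infdist ((real d + u) / real r) \<int> = 1 - (real d + u) / real r"
      by (intro infdist_Ints_upper_half)
    with False show ?thesis using r0 unfolding shear_def T offset_def step_def
      by (simp add: add_divide_distrib diff_divide_distrib left_diff_distrib right_diff_distrib
        distrib_left distrib_right)
  qed
qed

end

section \<open>Digit sequences\<close>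

definition tail :: "(nat \<Rightarrow> 'a) \<Rightarrow> nat \<Rightarrow> 'a" where
  "tail e = (\<lambda>j. e (Suc j))"

context even_base
begin

definition digits :: "(nat \<Rightarrow> nat) \<Rightarrow> bool" where
  "digits e \<longleftrightarrow> (\<forall>j. e j < r)"

definition radix :: "(nat \<Rightarrow> nat) \<Rightarrow> real" where
  "radix e = (\<Sum>j. real (e j) / real r ^ Suc j)"

lemma digits_tail: "digits e \<Longrightarrow> digits (tail e)"
  by (simp add: digits_def tail_def)

lemma radix_tail:
  assumes "digits e"
  shows "radix e = (real (e 0) + radix (tail e)) / real r"
proof -
  have sm: "summable (\<lambda>j. real (e j) / real r ^ Suc j)"
    "summable (\<lambda>j. real (tail e j) / real r ^ Suc j)"
    using summable_digits(1)[OF r] assms digits_tail[OF assms] unfolding digits_def by blast+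
  have "radix e = (\<Sum>j. real (e (Suc j)) / real r ^ Suc (Suc j)) + real (e 0) / real r"
    unfolding radix_def using suminf_split_head[OF sm(1)] by simp
  also have "(\<lambda>j. real (e (Suc j)) / real r ^ Suc (Suc j)) =
      (\<lambda>j. (real (tail e j) / real r ^ Suc j) / real r)"
    by (simp add: tail_def mult.commute)
  also have "(\<Sum>j. (real (tail e j) / real r ^ Suc j) / real r) = radix (tail e) / real r"
    unfolding radix_def by (rule suminf_divide[OF sm(2)])
  finally show ?thesis by (simp add: add_divide_distrib)
qed

lemma radix_nonneg: "digits e \<Longrightarrow> 0 \<le> radix e"
  and radix_le_1: "digits e \<Longrightarrow> radix e \<le> 1"
  unfolding radix_def digits_def
  by (intro suminf_nonneg summable_digits r; simp) (intro summable_digits r; simp)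

lemma is_expansion_iff: "is_expansion r x e \<longleftrightarrow> digits e \<and> radix e = x"
  using summable_digits(1)[OF r, of e]
  by (auto simp: is_expansion_def digits_def radix_def sums_iff)

lemma radix_eq_1D:
  assumes "digits e" "radix e = 1"
  shows "Suc (e j) = r"
  using assms
proof (induction j arbitrary: e)
  case (0 e)
  then show ?case
    using radix_tail[of e] radix_le_1[OF digits_tail, of e] r
    by (auto simp: digits_def field_simps dest: spec[of _ 0])
next
  case (Suc j e)
  have "e 0 < r" using Suc by (simp add: digits_def)
  then have "radix (tail e) = 1"
    using Suc radix_tail[of e] radix_le_1[OF digits_tail, of e] r
    by (simp add: field_simps)
  with Suc.IH[of "tail e"] digits_tail Suc.prems show ?case by (simp add: tail_def)
qed

lemma radix_eq_0D:
  assumes "digits e" "radix e = 0"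
  shows "e j = 0"
  using assms
proof (induction j arbitrary: e)
  case (0 e)
  then show ?case
    using radix_tail[of e] radix_nonneg[OF digits_tail, of e] r by simp
next
  case (Suc j e)
  then have "radix (tail e) = 0"
    using radix_tail[of e] radix_nonneg[OF digits_tail, of e] r by simp
  with Suc.IH[of "tail e"] digits_tail Suc.prems show ?case by (simp add: tail_def)
qed

text \<open>
  Both tails after the first difference have values in the unit interval and must make up for a
  digit difference of at least 1, so the tail after the smaller digit has value 1.
\<close>

lemma radix_eq_smaller_digit:
  assumes "digits a" "digits b" "radix a = radix b"
    and "\<And>j. j < n \<Longrightarrow> a j = b j" "b n < a n"
  shows "Suc (b (Suc n + i)) = r"
  using assms
proof (induction n arbitrary: a b)
  case (0 a b)
  have "real (b 0) + radix (tail b) = real (a 0) + radix (tail a)"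
    using 0 radix_tail[of a] radix_tail[of b] r by simp
  moreover have "real (b 0) + 1 \<le> real (a 0)" using 0 by linarith
  ultimately have "radix (tail b) = 1"
    using radix_le_1[OF digits_tail] radix_nonneg[OF digits_tail] 0 by (smt (verit))
  with radix_eq_1D[OF digits_tail] 0 show ?case by (simp add: tail_def)
next
  case (Suc n a b)
  have "radix (tail a) = radix (tail b)"
    using Suc.prems radix_tail[of a] radix_tail[of b] r by simp
  with Suc.IH[of "tail a" "tail b"] Suc.prems show ?case
    by (simp add: digits_tail) (simp add: tail_def)
qed

lemma expansion_is_expansion:
  assumes "0 < x" "x < 1"
  shows "digits (expansion r x)" "radix (expansion r x) = x"
    and "digits e \<Longrightarrow> radix e = x \<Longrightarrow> e \<noteq> expansion r x \<Longrightarrow>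
      \<forall>\<^sub>F k in sequentially. expansion r x k = 0"
proof -
  from theI'[OF ex1_expansion[OF r assms]]
  have "is_expansion r x (expansion r x) \<and>
      ((\<exists>e'. is_expansion r x e' \<and> e' \<noteq> expansion r x) \<longrightarrow>
        (\<forall>\<^sub>F k in sequentially. expansion r x k = 0))"
    unfolding expansion_def[symmetric] .
  then show "digits (expansion r x)" "radix (expansion r x) = x"
    "digits e \<Longrightarrow> radix e = x \<Longrightarrow> e \<noteq> expansion r x \<Longrightarrow>
      \<forall>\<^sub>F k in sequentially. expansion r x k = 0"
    unfolding is_expansion_iff by blast+
qed

lemma expansion_radix:
  assumes e: "digits e" and x: "0 < radix e" "radix e < 1"
    and nt: "\<And>n. \<exists>i. Suc (e (n + i)) \<noteq> r"
  shows "expansion r (radix e) = e"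
proof (rule ccontr)
  let ?x = "radix e" and ?a = "expansion r (radix e)"
  assume ne: "?a \<noteq> e"
  have a: "digits ?a" "radix ?a = radix e" by (rule expansion_is_expansion(1,2)[OF x])+
  have ev0: "\<forall>\<^sub>F k in sequentially. ?a k = 0"
    using e ne by (intro expansion_is_expansion(3)[OF x]) auto
  define n where "n = (LEAST n. ?a n \<noteq> e n)"
  have "\<exists>n. ?a n \<noteq> e n" using ne by auto
  then have n: "?a n \<noteq> e n" unfolding n_def by (rule LeastI_ex)
  have lt: "m < n \<Longrightarrow> ?a m = e m" for m unfolding n_def using not_less_Least by blast
  show False
  proof (cases "e n < ?a n")
    case True
    from radix_eq_smaller_digit[OF a(1) e a(2) lt True] nt show False by blast
  next
    case False
    then have "?a n < e n" using n by simp
    with lt have top: "Suc (?a (Suc n + i)) = r" for i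
      by (intro radix_eq_smaller_digit[OF e a(1) a(2)[symmetric]]) auto
    obtain K where "?a k = 0" if "k \<ge> K" for k
      using ev0 by (auto simp: eventually_sequentially)
    from this[of "Suc n + K"] top[of K] r show False by simp
  qed
qed

lemma expansion_exists:
  assumes "0 \<le> x" "x \<le> 1"
  obtains e where "digits e" "radix e = x"
proof -
  consider "x = 0" | "x = 1" | "0 < x" "x < 1" using assms by linarith
  then show ?thesis
  proof cases
    case 1
    show ?thesis using r by (intro that[of "\<lambda>_. 0"]) (auto simp: digits_def radix_def 1)
  next
    case 2
    have d: "digits (\<lambda>_. r - 1)" using r by (simp add: digits_def)
    have "tail (\<lambda>_. r - 1) = (\<lambda>_. r - 1)" by (simp add: tail_def)
    with radix_tail[OF d] have "radix (\<lambda>_. r - 1) * (real r - 1) = real r - 1"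
      using r by (simp add: field_simps)
    then have "radix (\<lambda>_. r - 1) = 1" using r by simp
    with d 2 show ?thesis by (intro that[of "\<lambda>_. r - 1"]) auto
  next
    case 3
    with expansion_is_expansion that show ?thesis by blast
  qed
qed

section \<open>Reflecting the digit walk\<close>

definition walk :: "int \<Rightarrow> (nat \<Rightarrow> nat) \<Rightarrow> nat \<Rightarrow> int" where
  "walk k e n = k + (\<Sum>j<n. step (e j))"

lemma walk_0 [simp]: "walk k e 0 = k"
  by (simp add: walk_def)

lemma walk_Suc: "walk k e (Suc n) = walk k e n + step (e n)"
  by (simp add: walk_def)

lemma walk_tail: "walk k e (Suc n) = walk (k + step (e 0)) (tail e) n"
  unfolding walk_def tail_def by (subst sum.lessThan_Suc_shift) simp

lemma step_cases: "step d = 1 \<and> 2 * d < r \<or> step d = - 1 \<and> 2 * d \<ge> r"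
  by (simp add: step_def)

lemma step_reflect: "d < r \<Longrightarrow> step (r - 1 - d) = - step d"
  using ev by (auto simp: step_def elim!: evenE)

lemma step_half [simp]: "step (r div 2) = - 1"
  using ev by (auto simp: step_def)

text \<open>
  The canonical member of a local level set has a nonnegative walk. It arises by reflecting the
  negative excursions (a digit \<open>d\<close> becomes \<open>r - 1 - d\<close>) and by choosing the digit \<open>r / 2\<close> at each
  return to zero, where local equivalence leaves the digit free. In \<open>reflect h d\<close> the argument \<open>h\<close>
  is the value of the walk after the digit \<open>d\<close>.
\<close>

definition reflect :: "int \<Rightarrow> nat \<Rightarrow> nat" where
  "reflect h d = (if h > 0 then d else if h < 0 then r - 1 - d else r div 2)"

definition reflected :: "int \<Rightarrow> (nat \<Rightarrow> nat) \<Rightarrow> nat \<Rightarrow> nat" where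
  "reflected k e j = reflect (walk k e (Suc j)) (e j)"

definition canonical :: "int \<Rightarrow> (nat \<Rightarrow> nat) \<Rightarrow> bool" where
  "canonical k e \<longleftrightarrow> digits e \<and>
     (\<forall>j. 0 \<le> walk k e j \<and> (walk k e (Suc j) = 0 \<longrightarrow> e j = r div 2))"

lemma reflect_less: "d < r \<Longrightarrow> reflect h d < r"
  using r by (auto simp: reflect_def)

lemma digits_reflected: "digits e \<Longrightarrow> digits (reflected k e)"
  by (simp add: digits_def reflected_def reflect_less)

lemma abs_add_step:
  assumes "d < r"
  shows "\<bar>h + step d\<bar> = \<bar>h\<bar> + step (reflect (h + step d) d)"
  using step_cases[of d] step_reflect[OF assms] by (auto simp: reflect_def)

lemma walk_reflected:
  assumes "digits e"
  shows "walk \<bar>k\<bar> (reflected k e) n = \<bar>walk k e n\<bar>"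
proof (induction n)
  case (Suc n)
  have "e n < r" using assms by (simp add: digits_def)
  from abs_add_step[OF this, of "walk k e n"] Suc show ?case
    by (simp add: walk_Suc reflected_def)
qed simp

lemma canonical_reflected: "digits e \<Longrightarrow> canonical \<bar>k\<bar> (reflected k e)"
  by (simp add: canonical_def digits_reflected walk_reflected) (simp add: reflected_def reflect_def)

lemma reflected_canonical: "canonical k e \<Longrightarrow> reflected k e = e"
proof
  fix j assume c: "canonical k e"
  then have "0 \<le> walk k e (Suc j)" "walk k e (Suc j) = 0 \<longrightarrow> e j = r div 2"
    unfolding canonical_def by blast+
  then show "reflected k e j = e j" by (auto simp: reflected_def reflect_def)
qed

text \<open>
  The value of the walk is the only memory of a canonical sequence: what follows the first digit
  is again canonical, from the new value. This is the source of all recursions below.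
\<close>

lemma canonical_tail:
  "canonical k e \<longleftrightarrow> 0 \<le> k \<and> e 0 < r \<and> (k + step (e 0) = 0 \<longrightarrow> e 0 = r div 2)
     \<and> canonical (k + step (e 0)) (tail e)"
proof -
  have d: "digits e \<longleftrightarrow> e 0 < r \<and> digits (tail e)"
    unfolding digits_def tail_def by (metis not0_implies_Suc)
  have all: "(\<forall>j. P j) \<longleftrightarrow> P 0 \<and> (\<forall>j. P (Suc j))" for P :: "nat \<Rightarrow> bool"
    by (metis not0_implies_Suc)
  show ?thesis
    unfolding canonical_def d all_conj_distrib all[of "\<lambda>j. 0 \<le> walk k e j"]
      all[of "\<lambda>j. walk k e (Suc j) = 0 \<longrightarrow> e j = r div 2"]
    by (simp add: walk_tail tail_def) (simp add: walk_tail[of "k + step (e 0)"] tail_def conj_ac)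
qed

text \<open>
  The top digit lowers the walk, which cannot stay nonnegative if it goes down forever. Hence no
  canonical sequence is the excluded one of two expansions of its value.
\<close>

lemma canonical_not_eventually_top:
  assumes "canonical k e"
  shows "\<exists>i. Suc (e (n + i)) \<noteq> r"
proof (rule ccontr)
  assume "\<not> ?thesis"
  then have top: "Suc (e (n + i)) = r" for i by blast
  have s: "step (e (n + i)) = - 1" for i
  proof -
    have "\<not> 2 * e (n + i) < r" using top[of i] r by linarith
    then show ?thesis by (simp add: step_def)
  qed
  have "walk k e (n + i) = walk k e n - int i" for i
    by (induction i) (simp_all add: walk_Suc s)
  from this[of "nat (walk k e n) + 1"] have "walk k e (n + (nat (walk k e n) + 1)) < 0"
    by simp
  moreover have "0 \<le> walk k e j" for j using assms unfolding canonical_def by blast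
  ultimately show False by (metis not_less)
qed

lemma reflected_tail: "tail (reflected k e) = reflected (k + step (e 0)) (tail e)"
  by (rule ext) (simp only: reflected_def tail_def[of "reflected k e"] walk_tail, simp add: tail_def)

text \<open>
  How one digit changes the constant by which a sheared value and its reflection differ. The
  correction \<open>max 0 (- k)\<close> comes from \<open>(- k) (1 - x) + T (1 - x) = k x + T x - k\<close>.
\<close>

lemma offset_reflect:
  assumes "d < r"
  shows "offset \<bar>k\<bar> (reflect (k + step d) d) + of_int (max 0 (- (k + step d)))
    = offset k d + real r * of_int (max 0 (- k))"
proof -
  have offset_eq: "offset k d = of_int (k + step d) * real d + real r * (1 - of_int (step d)) / 2"
    for k d by (simp add: offset_def step_def)
  consider "k + step d > 0" | "k + step d < 0" | "k + step d = 0" by linarith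
  then show ?thesis
  proof cases
    case 1
    then have "k \<ge> 0" using step_cases[of d] by linarith
    with 1 show ?thesis by (simp add: reflect_def)
  next
    case 2
    then have k: "k \<le> 0" using step_cases[of d] by linarith
    have c: "real (r - 1 - d) = real r - 1 - real d" using assms by linarith
    have "reflect (k + step d) d = r - 1 - d" using 2 by (simp add: reflect_def)
    moreover have "\<bar>k\<bar> = - k" "max 0 (- k) = - k" "max 0 (- (k + step d)) = - (k + step d)"
      using k 2 by auto
    moreover have "offset (- k) (r - 1 - d) = of_int (- k - step d) * (real r - 1 - real d)
        + real r * (1 + of_int (step d)) / 2"
      unfolding offset_eq step_reflect[OF assms] c by simp
    ultimately show ?thesis
      by (simp only: offset_eq) (simp add: field_simps)
  next
    case 3
    have "real (r div 2) = real r / 2" using ev by (simp add: real_of_nat_div)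
    moreover have "k = - step d" using 3 by linarith
    ultimately show ?thesis using step_cases[of d] by (auto simp: reflect_def offset_eq)
  qed
qed

lemma shear_radix_tail:
  assumes "digits e"
  shows "shear k (radix e) = (offset k (e 0) + shear (k + step (e 0)) (radix (tail e))) / real r"
  unfolding radix_tail[OF assms]
  using assms by (intro shear_digit radix_nonneg radix_le_1 digits_tail) (simp_all add: digits_def)

lemma shear_bounds:
  assumes "0 \<le> x" "x \<le> 1"
  shows "\<bar>shear k x\<bar> \<le> of_int \<bar>k\<bar> + 1"
proof -
  have "\<bar>of_int k * x\<bar> \<le> \<bar>of_int k\<bar>"
    using assms by (simp add: abs_mult mult_left_le)
  with Takagi_nonneg[of x] Takagi_le_1[of x] show ?thesis unfolding shear_def by simp
qed

text \<open>
  Reflection preserves the value of \<open>T\<close>. By \<open>offset_reflect\<close> both sides obey the same recursion, so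
  their difference is \<open>1 / r\<close> times the difference for the tail; it grows at most linearly in the
  value of the walk, which changes by one per digit, so iterating shows that it vanishes.
\<close>

lemma shear_reflected:
  assumes "digits e"
  shows "shear \<bar>k\<bar> (radix (reflected k e)) = shear k (radix e) + of_int (max 0 (- k))"
proof -
  \<comment> \<open>The claim is that this error is 0.\<close>
  define err where "err k e =
    shear \<bar>k\<bar> (radix (reflected k e)) - shear k (radix e) - of_int (max 0 (- k))" for k e
  have step1: "err k e = err (k + step (e 0)) (tail e) / real r" if "digits e" for k e
  proof -
    have d: "e 0 < r" using that by (simp add: digits_def)
    have r0: "reflected k e 0 = reflect (k + step (e 0)) (e 0)"
      by (simp add: reflected_def walk_Suc)
    have "shear \<bar>k\<bar> (radix (reflected k e)) =
        (offset \<bar>k\<bar> (reflect (k + step (e 0)) (e 0))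
          + shear \<bar>k + step (e 0)\<bar> (radix (reflected (k + step (e 0)) (tail e)))) / real r"
      using shear_radix_tail[OF digits_reflected[OF that], of "\<bar>k\<bar>" k]
      by (simp add: r0 reflected_tail flip: abs_add_step[OF d])
    then show ?thesis
      using shear_radix_tail[OF that, of k] offset_reflect[OF d, of k] r
      by (simp add: err_def field_simps)
  qed
  have bnd: "\<bar>err k e\<bar> \<le> 3 * of_int \<bar>k\<bar> + 2" if "digits e" for k e
  proof -
    have "\<bar>shear \<bar>k\<bar> (radix (reflected k e))\<bar> \<le> of_int \<bar>k\<bar> + 1" "\<bar>shear k (radix e)\<bar> \<le> of_int \<bar>k\<bar> + 1"
      using shear_bounds[OF radix_nonneg radix_le_1, OF digits_reflected digits_reflected,
          OF that that, of "\<bar>k\<bar>"]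
        shear_bounds[OF radix_nonneg radix_le_1, OF that that, of k] by simp_all
    moreover have "\<bar>real_of_int (max 0 (- k))\<bar> \<le> of_int \<bar>k\<bar>" by simp
    ultimately show ?thesis unfolding err_def by linarith
  qed
  have iter: "\<bar>err k e\<bar> \<le> (3 * (of_int \<bar>k\<bar> + real n) + 2) * (1 / real r) ^ n" if "digits e" for k e n
    using that
  proof (induction n arbitrary: k e)
    case (Suc n)
    have "\<bar>err k e\<bar> = \<bar>err (k + step (e 0)) (tail e)\<bar> * (1 / real r)"
      by (simp add: step1[OF Suc.prems])
    also have "\<dots> \<le> ((3 * (of_int \<bar>k + step (e 0)\<bar> + real n) + 2) * (1 / real r) ^ n) * (1 / real r)"
      by (intro mult_right_mono Suc.IH digits_tail Suc.prems) simp
    also have "\<dots> \<le> ((3 * (of_int \<bar>k\<bar> + real (Suc n)) + 2) * (1 / real r) ^ n) * (1 / real r)"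
    proof (intro mult_right_mono)
      have "\<bar>k + step (e 0)\<bar> \<le> \<bar>k\<bar> + 1" using step_cases[of "e 0"] by linarith
      then have "of_int \<bar>k + step (e 0)\<bar> \<le> (of_int \<bar>k\<bar> + 1 :: real)" by linarith
      then show "3 * (of_int \<bar>k + step (e 0)\<bar> + real n) + 2 \<le> 3 * (of_int \<bar>k\<bar> + real (Suc n)) + 2"
        by simp
    qed simp_all
    finally show ?case by (simp add: mult_ac)
  qed (use bnd in simp)
  have "(\<lambda>n. (3 * (of_int \<bar>k\<bar> + real n) + 2) * (1 / real r) ^ n) \<longlonglongrightarrow> 0"
  proof -
    have *: "(\<lambda>n. (1 / real r) ^ n) \<longlonglongrightarrow> 0" "(\<lambda>n. real n * (1 / real r) ^ n) \<longlonglongrightarrow> 0"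
      using r by (auto intro!: LIMSEQ_power_zero powser_times_n_limit_0)
    have "(\<lambda>n. (3 * of_int \<bar>k\<bar> + 2) * (1 / real r) ^ n + 3 * (real n * (1 / real r) ^ n))
        \<longlonglongrightarrow> (3 * of_int \<bar>k\<bar> + 2) * 0 + 3 * 0"
      by (intro tendsto_intros *)
    then show ?thesis by (simp add: algebra_simps)
  qed
  from LIMSEQ_le_const[OF this, of "\<bar>err k e\<bar>"] iter[OF assms, of k] have "\<bar>err k e\<bar> \<le> 0" by blast
  then show ?thesis by (simp add: err_def)
qed

section \<open>Local level sets correspond to canonical digit sequences\<close>

lemma digit_diff_eq_walk: "digit_diff r n x = walk 0 (expansion r x) n"
proof (induction n)
  case 0
  then show ?case by (simp add: digit_diff_def)
next
  case (Suc n)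
  have ins: "{j \<in> {1..Suc n}. P j} = (if P (Suc n) then insert (Suc n) {j \<in> {1..n}. P j}
      else {j \<in> {1..n}. P j})" for P
    by (auto simp: le_Suc_eq)
  have low: "real d < real r / 2 \<longleftrightarrow> 2 * d < r" "real d \<ge> real r / 2 \<longleftrightarrow> \<not> 2 * d < r" for d
    by linarith+
  have "digit_diff r (Suc n) x = digit_diff r n x + step (digit r x (Suc n))"
    unfolding digit_diff_def ins low by (simp add: step_def)
  with Suc show ?case by (simp add: walk_Suc digit_def)
qed

definition profile :: "real \<Rightarrow> nat \<Rightarrow> nat" where
  "profile x = reflected 0 (expansion r x)"

lemma canonical_profile: "0 < x \<Longrightarrow> x < 1 \<Longrightarrow> canonical 0 (profile x)"
  using canonical_reflected[OF expansion_is_expansion(1), of x 0] by (simp add: profile_def)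

lemma abs_digit_diff_eq_walk_profile:
  "0 < x \<Longrightarrow> x < 1 \<Longrightarrow> \<bar>digit_diff r n x\<bar> = walk 0 (profile x) n"
  using walk_reflected[OF expansion_is_expansion(1), of x 0 n]
  by (simp add: profile_def digit_diff_eq_walk)

lemma Takagi_profile: "0 < x \<Longrightarrow> x < 1 \<Longrightarrow> Takagi r (radix (profile x)) = Takagi r x"
  using shear_reflected[OF expansion_is_expansion(1), of x 0] expansion_is_expansion(2)[of x]
  by (simp add: profile_def shear_def)

lemma profile_nth:
  assumes "0 < x" "x < 1"
  shows "digit_diff r (Suc j) x \<noteq> 0 \<Longrightarrow>
      profile x j = digit r x (Suc j) \<or> profile x j + digit r x (Suc j) + 1 = r"
    and "digit_diff r (Suc j) x = 0 \<Longrightarrow> profile x j = r div 2"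
proof -
  have "expansion r x j < r"
    using expansion_is_expansion(1)[OF assms] by (simp add: digits_def)
  then show "digit_diff r (Suc j) x \<noteq> 0 \<Longrightarrow>
      profile x j = digit r x (Suc j) \<or> profile x j + digit r x (Suc j) + 1 = r"
    "digit_diff r (Suc j) x = 0 \<Longrightarrow> profile x j = r div 2"
    by (auto simp: profile_def reflected_def reflect_def digit_def digit_diff_eq_walk)
qed

text \<open>
  From equivalence to equal profiles: the profiles of equivalent points have the same walk, so their
  digits lie in the same half of \<open>{0..<r}\<close>, and two such digits cannot add up to \<open>r - 1\<close>.
\<close>

lemma loc_equiv_iff_profile_eq:
  assumes x: "0 < x" "x < 1" and x': "0 < x'" "x' < 1"
  shows "loc_equiv r x x' \<longleftrightarrow> profile x = profile x'"
proof
  assume eq: "profile x = profile x'"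
  show "loc_equiv r x x'"
    unfolding loc_equiv_def
  proof (intro allI impI)
    fix j :: nat assume "1 \<le> j"
    then obtain i where j: "j = Suc i" by (cases j) auto
    have abs: "\<bar>digit_diff r j x\<bar> = \<bar>digit_diff r j x'\<bar>"
      by (simp add: abs_digit_diff_eq_walk_profile x x' eq)
    moreover have "digit r x j = digit r x' j \<or> digit r x j + digit r x' j + 1 = r"
      if "\<bar>digit_diff r j x\<bar> > 0"
    proof -
      have "digit_diff r (Suc i) x \<noteq> 0" "digit_diff r (Suc i) x' \<noteq> 0"
        using that abs by (auto simp: j)
      then show ?thesis
        using profile_nth(1)[OF x, of i] profile_nth(1)[OF x', of i] by (auto simp: j eq)
    qed
    ultimately show "\<bar>digit_diff r j x\<bar> = \<bar>digit_diff r j x'\<bar> \<and> (\<bar>digit_diff r j x\<bar> > 0 \<longrightarrow>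
        digit r x j = digit r x' j \<or> digit r x j + digit r x' j + 1 = r)" by blast
  qed
next
  assume eq: "loc_equiv r x x'"
  have abs: "\<bar>digit_diff r n x\<bar> = \<bar>digit_diff r n x'\<bar>" for n
    using eq by (cases n) (auto simp: loc_equiv_def digit_diff_eq_walk)
  then have walk: "walk 0 (profile x) n = walk 0 (profile x') n" for n
    using abs_digit_diff_eq_walk_profile x x' by metis
  show "profile x = profile x'"
  proof
    fix j
    have same_half: "step (profile x j) = step (profile x' j)"
      using walk[of j] walk[of "Suc j"] by (simp add: walk_Suc)
    show "profile x j = profile x' j"
    proof (cases "digit_diff r (Suc j) x = 0")
      case True
      then show ?thesis using profile_nth(2) x x' abs[of "Suc j"] by simp
    next
      case False
      then have "digit r x (Suc j) = digit r x' (Suc j) \<or>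
          digit r x (Suc j) + digit r x' (Suc j) + 1 = r"
        using eq by (auto simp: loc_equiv_def)
      moreover have "digit_diff r (Suc j) x' \<noteq> 0" using False abs[of "Suc j"] by auto
      ultimately have "profile x j = profile x' j \<or> profile x j + profile x' j + 1 = r"
        using profile_nth(1)[OF x, of j] profile_nth(1)[OF x', of j] False by auto
      moreover have "profile x j + profile x' j + 1 \<noteq> r"
        using same_half ev by (auto simp: step_def split: if_splits elim!: evenE)
      ultimately show ?thesis by blast
    qed
  qed
qed

lemma local_level_set_eq:
  assumes "0 < x" "x < 1"
  shows "local_level_set r x = {x' \<in> {0<..<1}. profile x' = profile x}"
  using loc_equiv_iff_profile_eq assms by (auto simp: local_level_set_def)

lemma radix_canonical_bounds:
  assumes e: "canonical 0 e" "e \<noteq> (\<lambda>_. 0)"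
  shows "0 < radix e" "radix e < 1"
proof -
  have d: "digits e" using e by (simp add: canonical_def)
  show "0 < radix e" using radix_eq_0D[OF d] radix_nonneg[OF d] e(2) by force
  show "radix e < 1"
    using radix_eq_1D[OF d] radix_le_1[OF d] canonical_not_eventually_top[OF e(1)]
    by (metis order.not_eq_order_implies_strict)
qed

lemma profile_radix:
  assumes e: "canonical 0 e" "e \<noteq> (\<lambda>_. 0)"
  shows "profile (radix e) = e"
proof -
  have "digits e" using e by (simp add: canonical_def)
  then have "expansion r (radix e) = e"
    using expansion_radix radix_canonical_bounds[OF e] canonical_not_eventually_top[OF e(1)] by blast
  then show ?thesis by (simp add: profile_def reflected_canonical[OF e(1)])
qed

definition crossings :: "int \<Rightarrow> real \<Rightarrow> (nat \<Rightarrow> nat) set" where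
  "crossings k y = {e. canonical k e \<and> shear k (radix e) = y}"

text \<open>
  Every nonzero canonical sequence is the profile of its own value. The level \<open>y = 0\<close> is excluded
  because the zero sequence crosses it although its value 0 lies outside the open unit interval.
\<close>

lemma N_loc_eq_crossings:
  assumes "y \<noteq> 0"
  shows "N_loc r y = emeasure (count_space UNIV) (crossings 0 y)"
proof -
  let ?L = "\<lambda>e. {x \<in> {0<..<1}. profile x = e}"
  have nz: "e \<noteq> (\<lambda>_. 0)" if "e \<in> crossings 0 y" for e
    using that assms by (auto simp: crossings_def shear_def radix_def)
  have mem: "radix e \<in> ?L e" if "e \<in> crossings 0 y" for e
    using that nz[OF that] radix_canonical_bounds profile_radix by (auto simp: crossings_def)
  have inj: "inj_on ?L (crossings 0 y)"
  proof (rule inj_onI)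
    fix e e' assume "e \<in> crossings 0 y" "e' \<in> crossings 0 y" "?L e = ?L e'"
    with mem[of e] have "radix e \<in> ?L e'" by metis
    with mem[OF \<open>e \<in> crossings 0 y\<close>] show "e = e'" by simp
  qed
  have img: "{L. L \<subseteq> level_set r y \<and> (\<exists>x\<in>{0<..<1}. L = local_level_set r x)} = ?L ` crossings 0 y"
  proof (intro set_eqI iffI)
    fix L assume "L \<in> {L. L \<subseteq> level_set r y \<and> (\<exists>x\<in>{0<..<1}. L = local_level_set r x)}"
    then obtain x where x: "0 < x" "x < 1" and L: "L \<subseteq> level_set r y" "L = local_level_set r x"
      by auto
    have "x \<in> L" using x by (simp add: L local_level_set_eq)
    then have "Takagi r x = y" using L by (auto simp: level_set_def)
    then have "profile x \<in> crossings 0 y"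
      by (simp add: crossings_def canonical_profile x shear_def Takagi_profile)
    then show "L \<in> ?L ` crossings 0 y" using L(2) x by (auto simp: local_level_set_eq)
  next
    fix L assume "L \<in> ?L ` crossings 0 y"
    then obtain e where e: "e \<in> crossings 0 y" and L: "L = ?L e" by auto
    from mem[OF e] have re: "0 < radix e" "radix e < 1" "profile (radix e) = e" by auto
    then have "L = local_level_set r (radix e)" by (simp add: L local_level_set_eq)
    moreover have "L \<subseteq> level_set r y"
    proof
      fix x assume "x \<in> L"
      then have x: "0 < x" "x < 1" "profile x = e" by (auto simp: L)
      then have "Takagi r x = y" using Takagi_profile[of x] e by (simp add: crossings_def shear_def)
      then show "x \<in> level_set r y" using x by (simp add: level_set_def)
    qed
    ultimately show "L \<in> {L. L \<subseteq> level_set r y \<and> (\<exists>x\<in>{0<..<1}. L = local_level_set r x)}"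
      using re by auto
  qed
  have "bij_betw ?L (crossings 0 y) (?L ` crossings 0 y)" using inj by (simp add: bij_betw_def)
  from bij_betw_same_card[OF this] bij_betw_finite[OF this] show ?thesis
    unfolding N_loc_def img by (simp add: emeasure_count_space)
qed

end

section \<open>Counting by finite prefixes\<close>

definition truncate :: "nat \<Rightarrow> (nat \<Rightarrow> 'a) \<Rightarrow> 'a list" where
  "truncate n e = map e [0..<n]"

lemma truncate_Suc: "truncate (Suc n) e = e 0 # truncate n (tail e)"
  by (simp add: truncate_def tail_def upt_conv_Cons map_Suc_upt[symmetric] comp_def
      del: upt_Suc map_Suc_upt)

lemma truncate_eq_iff: "truncate n e = truncate n e' \<longleftrightarrow> (\<forall>j<n. e j = e' j)"
  by (auto simp: truncate_def)

lemma inj_on_truncate: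
  fixes B :: "(nat \<Rightarrow> 'a) set"
  assumes "finite B"
  shows "\<exists>n. inj_on (truncate n) B"
proof -
  \<comment> \<open>The sum bounds all positions of first difference from above, also for an empty set.\<close>
  define gap where "gap = (\<lambda>(a, b). LEAST j::nat. a j \<noteq> (b j :: 'a))"
  define n where "n = Suc (\<Sum>p\<in>B \<times> B. gap p)"
  have "inj_on (truncate n) B"
  proof (rule inj_onI, rule ccontr)
    fix a b assume ab: "a \<in> B" "b \<in> B" "truncate n a = truncate n b" "a \<noteq> b"
    then have "\<exists>j. a j \<noteq> b j" by auto
    then have "a (gap (a, b)) \<noteq> b (gap (a, b))" unfolding gap_def by simp (rule LeastI_ex)
    moreover have "gap (a, b) \<le> (\<Sum>p\<in>B \<times> B. gap p)"
      using ab assms by (intro member_le_sum) auto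
    then have "gap (a, b) < n" unfolding n_def by simp
    ultimately show False using ab by (simp add: truncate_eq_iff)
  qed
  then show ?thesis ..
qed

lemma card_truncate_mono:
  assumes "finite (truncate n ` A)" "m \<le> n"
  shows "card (truncate m ` A) \<le> card (truncate n ` A)"
proof -
  have "truncate m e = take m (truncate n e)" for e :: "nat \<Rightarrow> 'a"
    using assms by (simp add: truncate_def take_map take_upt)
  then have "truncate m ` A = take m ` truncate n ` A" by (auto simp: image_image)
  then show ?thesis using card_image_le[OF assms(1), of "take m"] by simp
qed

text \<open>
  Finitely many sequences are told apart by sufficiently long prefixes, so the number of sequences
  in a set is the limit of the increasing numbers of prefixes of given length.
\<close>

lemma emeasure_count_space_eq_SUP_truncate:
  assumes fin: "\<And>n. finite (truncate n ` A)"
  shows "emeasure (count_space UNIV) A = (SUP n. of_nat (card (truncate n ` A)))"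
proof (rule antisym)
  have le: "of_nat (card B) \<le> (SUP n. of_nat (card (truncate n ` A)) :: ennreal)"
    if B: "finite B" "B \<subseteq> A" for B
  proof -
    obtain n where "inj_on (truncate n) B" using inj_on_truncate[OF B(1)] by blast
    then have "card B = card (truncate n ` B)" by (simp add: card_image)
    also have "\<dots> \<le> card (truncate n ` A)" using B fin by (intro card_mono) auto
    finally have "of_nat (card B) \<le> (of_nat (card (truncate n ` A)) :: ennreal)" by simp
    then show ?thesis by (rule SUP_upper2[OF UNIV_I])
  qed
  show "emeasure (count_space UNIV) A \<le> (SUP n. of_nat (card (truncate n ` A)))"
  proof (cases "finite A")
    case True
    then show ?thesis using le[of A] by (simp add: emeasure_count_space)
  next
    case False
    have "of_nat N \<le> (SUP n. of_nat (card (truncate n ` A)) :: ennreal)" for N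
    proof -
      obtain B where "B \<subseteq> A" "finite B" "card B = N"
        using infinite_arbitrarily_large[OF False] by blast
      with le[of B] show ?thesis by simp
    qed
    then have "(SUP N. of_nat N) \<le> (SUP n. of_nat (card (truncate n ` A)) :: ennreal)"
      by (rule SUP_least)
    then have "(SUP n. of_nat (card (truncate n ` A))) = (top :: ennreal)"
      by (simp only: ennreal_SUP_of_nat_eq_top top_unique)
    then show ?thesis by (simp only: top_greatest)
  qed
  show "(SUP n. of_nat (card (truncate n ` A))) \<le> emeasure (count_space UNIV) A"
  proof (rule SUP_least)
    fix n
    show "of_nat (card (truncate n ` A)) \<le> emeasure (count_space UNIV) A"
      by (cases "finite A") (simp_all add: emeasure_count_space card_image_le)
  qed
qed

section \<open>The killed walk and its harmonic function\<close>

context even_base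
begin

text \<open>
  The transition operator of the walk with uniformly random digits, killed at the digits that a
  canonical sequence cannot use: from 0 the walk must go up, with probability \<open>1 / 2\<close>, and from 1
  it goes down only with the single digit \<open>r / 2\<close>, hence with probability \<open>1 / r\<close>.
\<close>

definition average :: "(nat \<Rightarrow> real) \<Rightarrow> nat \<Rightarrow> real" where
  "average g k = (if k = 0 then g 1 / 2 else if k = 1 then g 2 / 2 + g 0 / real r
     else (g (k + 1) + g (k - 1)) / 2)"

text \<open>
  Harmonicity at all \<open>k \<ge> 2\<close> forces an affine function on \<open>k \<ge> 1\<close>; the slope is 1 as for the
  lengths of the images, and the equations at 0 and 1 fix the constant term and the value at 0.
\<close>

definition harmonic :: "nat \<Rightarrow> real" where
  "harmonic k = (if k = 0 then real r / (2 * (real r - 1)) else real k + 1 / (real r - 1))"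

lemma average_harmonic: "average harmonic = harmonic"
proof
  fix k :: nat
  have "real r - 1 > 0" using r by simp
  consider "k = 0" | "k = 1" | "k \<ge> 2" by linarith
  then show "average harmonic k = harmonic k"
  proof cases
    case 3
    then show ?thesis by (simp add: average_def harmonic_def of_nat_diff)
  qed (use \<open>real r - 1 > 0\<close> r in \<open>simp_all add: average_def harmonic_def field_simps\<close>)
qed

lemma average_mono: "(\<And>k. g k \<le> h k) \<Longrightarrow> average g k \<le> average h k"
  by (auto simp: average_def intro!: add_mono divide_right_mono)

lemma average_add: "average (\<lambda>k. g k + h k) k = average g k + average h k"
  by (simp add: average_def add_divide_distrib)

lemma average_iterate_nonneg: "(\<And>k. 0 \<le> g k) \<Longrightarrow> 0 \<le> (average ^^ n) g k"
  by (induction n arbitrary: k) (auto simp: average_def)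

lemma tendsto_average:
  assumes "\<And>k. (\<lambda>n. g n k) \<longlonglongrightarrow> l k"
  shows "(\<lambda>n. average (g n) k) \<longlonglongrightarrow> average l k"
  unfolding average_def using r by (auto intro!: tendsto_intros assms)

text \<open>
  An affine function that is bounded is constant, and the killing at 0 and 1 admits no constant
  but 0.
\<close>

lemma bounded_harmonic_eq_0:
  assumes h: "average l = l" and l: "\<And>k. 0 \<le> l k" "\<And>k. l k \<le> 1"
  shows "l k = 0"
proof -
  define s where "s = l 2 - l 1"
  have eq: "l 0 = l 1 / 2" "l 1 = l 2 / 2 + l 0 / real r"
    "l (Suc (Suc j)) = (l (Suc (Suc (Suc j))) + l (Suc j)) / 2" for j
    using fun_cong[OF h, of 0] fun_cong[OF h, of 1] fun_cong[OF h, of "Suc (Suc j)"]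
    by (simp_all add: average_def)
  have lin: "l (Suc j) = l 1 + real j * s" for j
  proof -
    have "l (Suc j) = l 1 + real j * s \<and> l (Suc (Suc j)) = l 1 + real (Suc j) * s"
    proof (induction j)
      case (Suc j)
      then show ?case using eq(3)[of j] by (simp add: algebra_simps)
    qed (simp add: s_def numeral_2_eq_2)
    then show ?thesis ..
  qed
  have "s = 0"
  proof (rule ccontr)
    assume "s \<noteq> 0"
    then obtain j where "real j * \<bar>s\<bar> > 1"
      using reals_Archimedean3[of "\<bar>s\<bar>"] by auto
    moreover have "l (Suc j) - l 1 = real j * s" using lin[of j] by linarith
    ultimately have "\<bar>l (Suc j) - l 1\<bar> > 1" by (simp add: abs_mult)
    with l[of 1] l[of "Suc j"] show False by linarith
  qed
  then have const: "l (Suc j) = l 1" for j using lin[of j] by simp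
  have "l 1 * (1 - 1 / real r) = 0"
    using eq(1,2) const[of 1] r by (simp add: numeral_2_eq_2 field_simps)
  then have "l 1 = 0" using r by simp
  then show ?thesis using const[of "k - 1"] eq(1) by (cases "k = 0") simp_all
qed

text \<open>
  The survival probability decreases to a bounded harmonic function, which is 0.
\<close>

lemma average_iterate_1_tendsto_0: "(\<lambda>n. (average ^^ n) (\<lambda>_. 1) k) \<longlonglongrightarrow> 0"
proof -
  let ?u = "\<lambda>n. (average ^^ n) (\<lambda>_. 1)"
  have dec: "?u (Suc n) k \<le> ?u n k" for n k
  proof (induction n arbitrary: k)
    case 0
    have "1 / real r \<le> 1 / 2" using r by (intro divide_left_mono) auto
    then show ?case by (simp add: average_def)
  next
    case (Suc n)
    then show ?case using average_mono[of "?u (Suc n)" "?u n" k] by simp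
  qed
  have nonneg: "0 \<le> ?u n k" for n k by (rule average_iterate_nonneg) simp
  have "decseq (\<lambda>n. ?u n k)" for k using dec by (rule decseq_SucI)
  then have "convergent (\<lambda>n. ?u n k)" for k
    using nonneg by (metis decseq_convergent convergentI)
  then obtain l where l: "(\<lambda>n. ?u n k) \<longlonglongrightarrow> l k" for k
    unfolding convergent_def by metis
  have "average l k = l k" for k
  proof (rule LIMSEQ_unique)
    show "(\<lambda>n. ?u (Suc n) k) \<longlonglongrightarrow> average l k" using tendsto_average[OF l] by simp
    show "(\<lambda>n. ?u (Suc n) k) \<longlonglongrightarrow> l k" using l by (rule LIMSEQ_Suc)
  qed
  moreover have "0 \<le> l k" for k
    using LIMSEQ_le_const[OF l] nonneg by blast
  moreover have "?u n k \<le> 1" for n k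
    by (induction n) (simp, rule order_trans[OF dec])
  then have "l k \<le> 1" for k
    using LIMSEQ_le_const2[OF l] by blast
  ultimately have "l k = 0" for k
    by (intro bounded_harmonic_eq_0) auto
  with l show ?thesis by simp
qed

lemma average_iterate_tendsto_harmonic:
  assumes "\<And>k. \<bar>g k - harmonic k\<bar> \<le> 1"
  shows "(\<lambda>n. (average ^^ n) g k) \<longlonglongrightarrow> harmonic k"
proof -
  have "\<bar>(average ^^ n) g k - harmonic k\<bar> \<le> (average ^^ n) (\<lambda>_. 1) k" for n k
  proof (induction n arbitrary: k)
    case 0
    then show ?case by (simp add: assms)
  next
    case (Suc n)
    let ?g = "(average ^^ n) g" and ?u = "(average ^^ n) (\<lambda>_. 1)"
    have "average ?g k \<le> average (\<lambda>k. harmonic k + ?u k) k"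
      "average harmonic k \<le> average (\<lambda>k. ?g k + ?u k) k"
      using Suc by (auto intro!: average_mono simp: abs_le_iff algebra_simps)
    then show ?case by (simp add: average_add average_harmonic abs_le_iff)
  qed
  then have "(\<lambda>n. (average ^^ n) g k - harmonic k) \<longlonglongrightarrow> 0"
    by (intro Lim_null_comparison[OF _ average_iterate_1_tendsto_0[of k]]) simp
  then show ?thesis by (simp add: LIM_zero_iff)
qed

section \<open>Counting crossings by their first digits\<close>

text \<open>
  The image of the sheared graph is an interval starting at 0, so its length is its maximum.
\<close>

definition peak :: "nat \<Rightarrow> real" where
  "peak k = Sup (shear (int k) ` {0..1})"

lemma shear_image: "shear (int k) ` {0..1} = {0..peak k}"
  and peak_bounds: "real k \<le> peak k" "peak k \<le> real k + 1"
proof -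
  let ?I = "shear (int k) ` {0..1}"
  have cont: "continuous_on {0..1} (shear (int k))"
    unfolding shear_def[abs_def] by (intro continuous_intros continuous_on_Takagi)
  have compact: "compact ?I" using cont by (rule compact_continuous_image) simp
  have connected: "connected ?I" using cont by (rule connected_continuous_image) simp
  have upper: "y \<le> real k + 1" if "y \<in> ?I" for y
  proof -
    obtain x where x: "0 \<le> x" "x \<le> 1" "y = shear (int k) x" using \<open>y \<in> ?I\<close> by auto
    from shear_bounds[OF x(1,2), of "int k"] x(3) show ?thesis by simp
  qed
  have lower: "0 \<le> y" if "y \<in> ?I" for y
    using that Takagi_nonneg by (auto simp: shear_def)
  have zero: "0 \<in> ?I" by (intro image_eqI[of _ _ 0]) (simp_all add: shear_def)
  have bdd: "bdd_above ?I" using upper by (rule bdd_aboveI)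
  have "shear (int k) 1 \<in> ?I" by simp
  then have "real k + Takagi r 1 \<in> ?I" by (simp add: shear_def)
  from cSup_upper[OF this bdd] Takagi_nonneg[of 1] show "real k \<le> peak k"
    unfolding peak_def by linarith
  show "peak k \<le> real k + 1" unfolding peak_def using zero upper by (intro cSup_least) auto
  have "peak k \<in> ?I"
    unfolding peak_def
    using zero bdd compact_imp_closed[OF compact] by (intro closed_contains_Sup) auto
  with connected zero have "{0..peak k} \<subseteq> ?I" by (intro connected_contains_Icc)
  moreover have "?I \<subseteq> {0..peak k}"
    using lower cSup_upper[OF _ bdd] unfolding peak_def by auto
  ultimately show "?I = {0..peak k}" by blast
qed

lemma peak_0: "peak 0 = real r ^ 2 / (2 * real r ^ 2 - 2)"
  and Takagi_image: "Takagi r ` {0..1} = {0..real r ^ 2 / (2 * real r ^ 2 - 2)}"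
proof -
  have "shear (int 0) = Takagi r" by (simp add: shear_def fun_eq_iff)
  with shear_image[of 0] have I: "Takagi r ` {0..1} = {0..peak 0}" by simp
  have "peak 0 \<in> Takagi r ` {0..1}" using I peak_bounds[of 0] by simp
  then have "peak 0 \<le> real r ^ 2 / (2 * real r ^ 2 - 2)" using Takagi_le by auto
  moreover have "real r / (2 * (real r + 1)) \<in> {0..1}" by simp
  then have "Takagi r (real r / (2 * (real r + 1))) \<in> {0..peak 0}" unfolding I[symmetric] by blast
  then have "real r ^ 2 / (2 * real r ^ 2 - 2) \<le> peak 0" unfolding Takagi_attains_max by simp
  ultimately show "peak 0 = real r ^ 2 / (2 * real r ^ 2 - 2)" by simp
  with I show "Takagi r ` {0..1} = {0..real r ^ 2 / (2 * real r ^ 2 - 2)}" by simp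
qed

text \<open>
  Reflection replaces any point of the graph by a canonical sequence with the same value, so the
  canonical sequences, though a null set, still take every value of the sheared function.
\<close>

lemma crossings_eq_empty_iff: "crossings (int k) y = {} \<longleftrightarrow> y \<notin> {0..peak k}"
proof
  assume empty: "crossings (int k) y = {}"
  show "y \<notin> {0..peak k}"
  proof
    assume "y \<in> {0..peak k}"
    then obtain x where x: "0 \<le> x" "x \<le> 1" "shear (int k) x = y"
      unfolding shear_image[symmetric] by auto
    obtain e where e: "digits e" "radix e = x" using expansion_exists[OF x(1,2)] .
    have "reflected (int k) e \<in> crossings (int k) y"
      using canonical_reflected[OF e(1), of "int k"] shear_reflected[OF e(1), of "int k"] e x
      by (simp add: crossings_def)
    with empty show False by simp
  qed
next
  assume "y \<notin> {0..peak k}"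
  then show "crossings (int k) y = {}"
    using radix_nonneg radix_le_1
    by (fastforce simp: shear_image[symmetric] crossings_def canonical_def)
qed

definition branches :: "int \<Rightarrow> nat set" where
  "branches k = {d. d < r \<and> 0 \<le> k + step d \<and> (k + step d = 0 \<longrightarrow> d = r div 2)}"

lemma finite_branches [simp]: "finite (branches k)"
  by (rule finite_subset[of _ "{..<r}"]) (auto simp: branches_def)

lemma mem_crossings_iff:
  assumes "0 \<le> k"
  shows "e \<in> crossings k y \<longleftrightarrow>
    e 0 \<in> branches k \<and> tail e \<in> crossings (k + step (e 0)) (real r * y - offset k (e 0))"
proof -
  have ge: "canonical (k + step (e 0)) (tail e) \<Longrightarrow> 0 \<le> k + step (e 0)"
    unfolding canonical_def by (metis walk_0)
  have "shear k (radix e) = y \<longleftrightarrow>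
      shear (k + step (e 0)) (radix (tail e)) = real r * y - offset k (e 0)" if "canonical k e"
    using that shear_radix_tail[of e k] r by (auto simp: canonical_def field_simps)
  then show ?thesis
    using ge assms unfolding crossings_def branches_def mem_Collect_eq
    by (subst (1) canonical_tail) (metis canonical_tail)
qed

text \<open>
  The identification of the branching with the killed walk: half of the digits lead up, and the
  number of admissible digits leading down is 0, 1 or \<open>r / 2\<close>.
\<close>

lemma sum_branches:
  "(\<Sum>d\<in>branches (int k). g (nat (int k + step d))) = real r * average g k"
proof -
  obtain m where m: "r = 2 * m" using ev by (elim evenE)
  have m0: "m > 0" using r m by simp
  have low: "step d = 1" if "d < m" for d using that m unfolding step_def by simp
  have high: "step d = - 1" if "d \<ge> m" for d using that m unfolding step_def by simp
  have half: "r div 2 = m" "m < r" using m m0 by auto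
  have lt: "d < r" if "d < m" for d using that m by simp
  let ?up = "{..<m}" and ?down = "{d \<in> branches (int k). m \<le> d}"
  have split: "branches (int k) = ?up \<union> ?down"
    using low lt by (auto simp: branches_def)
  have "(\<Sum>d\<in>branches (int k). g (nat (int k + step d))) =
      (\<Sum>d\<in>?up. g (nat (int k + step d))) + (\<Sum>d\<in>?down. g (nat (int k + step d)))"
    by (subst (1) split) (intro sum.union_disjoint, auto)
  also have "(\<Sum>d\<in>?up. g (nat (int k + step d))) = (\<Sum>d\<in>?up. g (k + 1))"
    by (intro sum.cong) (auto simp: low nat_add_distrib)
  also have "(\<Sum>d\<in>?down. g (nat (int k + step d))) = (\<Sum>d\<in>?down. g (k - 1))"
  proof (intro sum.cong refl)
    fix d assume "d \<in> ?down"
    moreover have "nat (int k - 1) = k - 1" by linarith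
    ultimately show "g (nat (int k + step d)) = g (k - 1)" using high by simp
  qed
  also have "?down = (if k = 0 then {} else if k = 1 then {m} else {m..<r})"
    using high half by (auto simp: branches_def)
  also have "(\<Sum>d\<in>?up. g (k + 1)) = real r / 2 * g (k + 1)" by (simp add: m)
  also have "(\<Sum>d\<in>(if k = 0 then {} else if k = 1 then {m} else {m..<r}). g (k - 1)) =
      (if k = 0 then 0 else if k = 1 then g 0 else real r / 2 * g (k - 1))" by (simp add: m)
  finally show ?thesis using r by (simp add: average_def numeral_2_eq_2 distrib_left)
qed

text \<open>
  The number of intervals of length \<open>1 / r ^ n\<close>, given by the first \<open>n\<close> digits, that contain a
  canonical point at the level \<open>y\<close> of the graph sheared by \<open>k\<close>.
\<close>

definition visits :: "nat \<Rightarrow> int \<Rightarrow> real \<Rightarrow> nat" where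
  "visits n k y = card (truncate n ` crossings k y)"

lemma finite_truncate_crossings: "finite (truncate n ` crossings k y)"
proof (rule finite_subset)
  show "truncate n ` crossings k y \<subseteq> {xs. set xs \<subseteq> {..<r} \<and> length xs = n}"
    by (auto simp: truncate_def crossings_def canonical_def digits_def)
  show "finite {xs. set xs \<subseteq> {..<r} \<and> length xs = n}"
    by (rule finite_lists_length_eq) simp
qed

lemma visits_0: "of_nat (visits 0 (int k) y) = (indicator {0..peak k} y :: ennreal)"
proof (cases "crossings (int k) y = {}")
  case False
  then have "truncate 0 ` crossings (int k) y = {[]}" by (auto simp: truncate_def)
  then show ?thesis using False crossings_eq_empty_iff[of k y] by (simp add: visits_def)
qed (use crossings_eq_empty_iff[of k y] in \<open>simp add: visits_def\<close>)

lemma visits_Suc: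
  assumes "0 \<le> k"
  shows "visits (Suc n) k y =
    (\<Sum>d\<in>branches k. visits n (k + step d) (real r * y - offset k d))"
proof -
  let ?C = "\<lambda>d. crossings (k + step d) (real r * y - offset k d)"
  have "truncate (Suc n) ` crossings k y = (\<Union>d\<in>branches k. (#) d ` truncate n ` ?C d)"
  proof (intro set_eqI iffI)
    fix w assume "w \<in> truncate (Suc n) ` crossings k y"
    then obtain e where "e \<in> crossings k y" "w = e 0 # truncate n (tail e)"
      by (auto simp: truncate_Suc)
    then show "w \<in> (\<Union>d\<in>branches k. (#) d ` truncate n ` ?C d)"
      using mem_crossings_iff[OF assms, of e y] by blast
  next
    fix w assume "w \<in> (\<Union>d\<in>branches k. (#) d ` truncate n ` ?C d)"
    then obtain d e where d: "d \<in> branches k" "e \<in> ?C d" "w = d # truncate n e" by auto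
    have "case_nat d e \<in> crossings k y"
      using d by (simp add: mem_crossings_iff[OF assms] tail_def)
    moreover have "w = truncate (Suc n) (case_nat d e)" using d by (simp add: truncate_Suc tail_def)
    ultimately show "w \<in> truncate (Suc n) ` crossings k y" by blast
  qed
  then have "visits (Suc n) k y = card (\<Union>d\<in>branches k. (#) d ` truncate n ` ?C d)"
    by (simp add: visits_def)
  also have "\<dots> = (\<Sum>d\<in>branches k. card ((#) d ` truncate n ` ?C d))"
    by (intro card_UN_disjoint) (auto simp: finite_truncate_crossings)
  also have "\<dots> = (\<Sum>d\<in>branches k. visits n (k + step d) (real r * y - offset k d))"
    by (intro sum.cong) (simp_all add: visits_def card_image)
  finally show ?thesis .
qed

lemma peak_iterate_nonneg: "0 \<le> (average ^^ n) peak k"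
proof (rule average_iterate_nonneg)
  show "0 \<le> peak k" for k using peak_bounds(1)[of k] by simp
qed

text \<open>
  Splitting off the first digit shrinks the levels by the factor \<open>r\<close>, which turns the sum over the
  admissible digits into an average; the recursion starts from the length of the image.
\<close>

lemma nn_integral_visits:
  "(\<lambda>y. of_nat (visits n (int k) y) :: ennreal) \<in> borel_measurable borel"
  "(\<integral>\<^sup>+ y. of_nat (visits n (int k) y) \<partial>lborel) = ennreal ((average ^^ n) peak k)"
proof -
  have "(\<lambda>y. of_nat (visits n (int k) y) :: ennreal) \<in> borel_measurable borel \<and>
    (\<integral>\<^sup>+ y. of_nat (visits n (int k) y) \<partial>lborel) = ennreal ((average ^^ n) peak k)"
  proof (induction n arbitrary: k)
    case 0
    then show ?case using peak_bounds(1)[of k] by (simp add: visits_0)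
  next
    case (Suc n)
    let ?f = "\<lambda>d y. of_nat (visits n (int k + step d) y) :: ennreal"
    let ?k = "\<lambda>d. nat (int k + step d)"
    have k: "int (?k d) = int k + step d" if "d \<in> branches (int k)" for d
      using that by (simp add: branches_def)
    have meas: "?f d \<in> borel_measurable borel"
      and int: "(\<integral>\<^sup>+ y. ?f d y \<partial>lborel) = ennreal ((average ^^ n) peak (?k d))"
      if "d \<in> branches (int k)" for d
      using Suc.IH[of "?k d"] unfolding k[OF that] by simp_all
    have eq: "(of_nat (visits (Suc n) (int k) y) :: ennreal) =
        (\<Sum>d\<in>branches (int k). ?f d (real r * y - offset (int k) d))" for y
      by (simp add: visits_Suc)
    have meas': "(\<lambda>y. ?f d (real r * y - offset (int k) d)) \<in> borel_measurable borel"
      if "d \<in> branches (int k)" for d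
      by (rule measurable_compose[OF _ meas[OF that]]) simp
    have scaled: "(\<integral>\<^sup>+ y. ?f d (real r * y - offset (int k) d) \<partial>lborel) =
        ennreal ((average ^^ n) peak (?k d) / real r)" if d: "d \<in> branches (int k)" for d
    proof -
      \<comment> \<open>The substitution is the inverse of the affine map from \<open>y\<close> to the level for the tail.\<close>
      have cancel: "real r * (offset (int k) d / real r + 1 / real r * y) - offset (int k) d = y" for y
        using r by (simp add: field_simps)
      have "(\<integral>\<^sup>+ y. ?f d (real r * y - offset (int k) d) \<partial>lborel) =
          ennreal (1 / real r) * (\<integral>\<^sup>+ y. ?f d y \<partial>lborel)"
        using nn_integral_real_affine[OF meas'[OF d], of "1 / real r" "offset (int k) d / real r"] r
        unfolding cancel by simp
      then show ?thesis
        using r by (simp add: int[OF d] peak_iterate_nonneg flip: ennreal_mult')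
    qed
    have "(\<integral>\<^sup>+ y. of_nat (visits (Suc n) (int k) y) \<partial>lborel) =
        (\<Sum>d\<in>branches (int k). ennreal ((average ^^ n) peak (?k d) / real r))"
      unfolding eq using meas' by (subst nn_integral_sum) (auto simp: scaled)
    also have "\<dots> = ennreal (\<Sum>d\<in>branches (int k). (average ^^ n) peak (?k d) / real r)"
      by (intro sum_ennreal) (simp add: peak_iterate_nonneg)
    also have "(\<Sum>d\<in>branches (int k). (average ^^ n) peak (?k d) / real r) =
        (average ^^ Suc n) peak k"
      using sum_branches[of "(average ^^ n) peak" k] r by (simp flip: sum_divide_distrib)
    finally have "(\<integral>\<^sup>+ y. of_nat (visits (Suc n) (int k) y) \<partial>lborel) =
        ennreal ((average ^^ Suc n) peak k)" .
    moreover have "(\<lambda>y. of_nat (visits (Suc n) (int k) y) :: ennreal) \<in> borel_measurable borel"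
      unfolding eq using meas' by (intro borel_measurable_sum) auto
    ultimately show ?case by blast
  qed
  then show "(\<lambda>y. of_nat (visits n (int k) y) :: ennreal) \<in> borel_measurable borel"
    "(\<integral>\<^sup>+ y. of_nat (visits n (int k) y) \<partial>lborel) = ennreal ((average ^^ n) peak k)"
    by blast+
qed

text \<open>
  The maximum of \<open>k x + T x\<close> differs by at most 1 from the harmonic function, because
  \<open>T\<close> has values in the unit interval, so the integrals converge to the harmonic function at 0.
\<close>

lemma nn_integral_crossings:
  "(\<lambda>y. emeasure (count_space UNIV) (crossings 0 y)) \<in> borel_measurable borel"
  "(\<integral>\<^sup>+ y. emeasure (count_space UNIV) (crossings 0 y) \<partial>lborel) =
    ennreal (real r / (2 * (real r - 1)))"
proof -
  let ?v = "\<lambda>n y. of_nat (visits n (int 0) y) :: ennreal"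
  have eq: "emeasure (count_space UNIV) (crossings 0 y) = (SUP n. ?v n y)" for y
    using emeasure_count_space_eq_SUP_truncate[OF finite_truncate_crossings, of 0 y]
    by (simp add: visits_def)
  show "(\<lambda>y. emeasure (count_space UNIV) (crossings 0 y)) \<in> borel_measurable borel"
    unfolding eq using nn_integral_visits(1)[of _ 0] by (intro borel_measurable_SUP) auto
  have inc: "incseq ?v"
    unfolding visits_def
    by (intro incseq_SucI le_funI of_nat_mono card_truncate_mono finite_truncate_crossings) simp
  have inc_integral: "incseq (\<lambda>n. \<integral>\<^sup>+ y. ?v n y \<partial>lborel)"
    by (intro incseq_SucI nn_integral_mono) (rule le_funD[OF incseq_SucD[OF inc]])
  have "(\<integral>\<^sup>+ y. (SUP n. ?v n y) \<partial>lborel) = (SUP n. \<integral>\<^sup>+ y. ?v n y \<partial>lborel)"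
    using nn_integral_visits(1)[of _ 0] inc
    by (intro nn_integral_monotone_convergence_SUP) auto
  also have "\<dots> = ennreal (harmonic 0)"
  proof (rule LIMSEQ_unique)
    show "(\<lambda>n. \<integral>\<^sup>+ y. ?v n y \<partial>lborel) \<longlonglongrightarrow> (SUP n. \<integral>\<^sup>+ y. ?v n y \<partial>lborel)"
      using inc_integral by (rule LIMSEQ_SUP)
    have "\<bar>peak k - harmonic k\<bar> \<le> 1" for k
    proof -
      have "0 \<le> harmonic k - real k" "harmonic k - real k \<le> 1"
        using r by (auto simp: harmonic_def field_simps)
      then show ?thesis using peak_bounds[of k] by linarith
    qed
    then show "(\<lambda>n. \<integral>\<^sup>+ y. ?v n y \<partial>lborel) \<longlonglongrightarrow> ennreal (harmonic 0)"
      unfolding nn_integral_visits(2) by (intro tendsto_ennrealI average_iterate_tendsto_harmonic)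
  qed
  finally show "(\<integral>\<^sup>+ y. emeasure (count_space UNIV) (crossings 0 y) \<partial>lborel) =
      ennreal (real r / (2 * (real r - 1)))"
    unfolding eq by (simp add: harmonic_def)
qed

lemma measurable_N_loc: "N_loc r \<in> borel_measurable borel"
proof -
  have "N_loc r = (\<lambda>y. if y = 0 then N_loc r 0 else emeasure (count_space UNIV) (crossings 0 y))"
    by (auto simp: N_loc_eq_crossings)
  moreover have "\<dots> \<in> borel_measurable borel"
    using nn_integral_crossings(1) by (intro measurable_If) auto
  ultimately show ?thesis by simp
qed

lemma nn_integral_N_loc:
  "(\<integral>\<^sup>+ y \<in> {0 .. real r ^ 2 / (2 * real r ^ 2 - 2)}. N_loc r y \<partial>lborel) =
    ennreal (real r / (2 * (real r - 1)))"
proof -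
  have out: "crossings 0 y = {}" if "y \<notin> {0..real r ^ 2 / (2 * real r ^ 2 - 2)}" for y
    using crossings_eq_empty_iff[of 0 y] that by (simp add: peak_0)
  have "N_loc r y * indicator {0 .. real r ^ 2 / (2 * real r ^ 2 - 2)} y =
      emeasure (count_space UNIV) (crossings 0 y)" if "y \<noteq> 0" for y
    using out[of y] by (auto simp: N_loc_eq_crossings[OF that] indicator_def)
  then have "AE y in lborel. N_loc r y * indicator {0 .. real r ^ 2 / (2 * real r ^ 2 - 2)} y =
      emeasure (count_space UNIV) (crossings 0 y)"
    by (rule AE_mp[OF AE_lborel_singleton[of 0] AE_I2, rule_format])
  then show ?thesis
    by (subst nn_integral_cong_AE) (assumption, rule nn_integral_crossings(2))
qed

end

theorem theorem1p2:
  fixes r :: nat and M :: "'a measure" and Y :: "'a \<Rightarrow> real"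
  assumes "r \<ge> 2" and "even r"
    and "prob_space M" and "Y \<in> borel_measurable M"
    and "distr M lborel Y = uniform_measure lborel (Takagi r ` {0..1})"
  shows "Takagi r ` {0..1} = {0 .. real r ^ 2 / (2 * real r ^ 2 - 2)}
    \<and> N_loc r \<in> borel_measurable borel
    \<and> (\<integral>\<^sup>+ \<omega>. N_loc r (Y \<omega>) \<partial>M)
         = ennreal ((2 * real r ^ 2 - 2) / real r ^ 2)
           * (\<integral>\<^sup>+ y \<in> {0 .. real r ^ 2 / (2 * real r ^ 2 - 2)}. N_loc r y \<partial>lborel)
    \<and> ennreal ((2 * real r ^ 2 - 2) / real r ^ 2)
           * (\<integral>\<^sup>+ y \<in> {0 .. real r ^ 2 / (2 * real r ^ 2 - 2)}. N_loc r y \<partial>lborel)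
         = ennreal (1 + 1 / real r)"
proof -
  interpret even_base r by unfold_locales (fact assms)+
  let ?c = "real r ^ 2 / (2 * real r ^ 2 - 2)"
  have r2: "real r ^ 2 > 1" using r by (simp add: one_less_power)
  then have c: "?c > 0" using r by (intro divide_pos_pos) auto
  have Y: "Y \<in> measurable M lborel" using assms(4) by simp
  have "(\<integral>\<^sup>+ \<omega>. N_loc r (Y \<omega>) \<partial>M) = (\<integral>\<^sup>+ y. N_loc r y \<partial>distr M lborel Y)"
    using measurable_N_loc by (subst nn_integral_distr[OF Y]) auto
  also have "\<dots> = (\<integral>\<^sup>+ y. N_loc r y \<partial>uniform_measure lborel {0..?c})"
    by (simp only: assms(5) Takagi_image)
  also have "\<dots> = (\<integral>\<^sup>+ y \<in> {0..?c}. N_loc r y \<partial>lborel) / emeasure lborel {0..?c}"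
    using measurable_N_loc by (intro nn_integral_uniform_measure) auto
  also have "\<dots> = (\<integral>\<^sup>+ y \<in> {0..?c}. N_loc r y \<partial>lborel) / ennreal ?c"
    using c by simp
  also have "\<dots> = ennreal ((2 * real r ^ 2 - 2) / real r ^ 2) * (\<integral>\<^sup>+ y \<in> {0..?c}. N_loc r y \<partial>lborel)"
    using inverse_ennreal[OF c] by (simp add: divide_ennreal_def mult.commute)
  finally have "(\<integral>\<^sup>+ \<omega>. N_loc r (Y \<omega>) \<partial>M) =
      ennreal ((2 * real r ^ 2 - 2) / real r ^ 2) * (\<integral>\<^sup>+ y \<in> {0..?c}. N_loc r y \<partial>lborel)" .
  moreover have "ennreal ((2 * real r ^ 2 - 2) / real r ^ 2) * (\<integral>\<^sup>+ y \<in> {0..?c}. N_loc r y \<partial>lborel) =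
      ennreal (1 + 1 / real r)"
  proof -
    have "real r - 1 > 0" using r by simp
    moreover have "2 * real r ^ 2 - 2 = 2 * (real r + 1) * (real r - 1)"
      by (simp add: power2_eq_square algebra_simps)
    ultimately have "(2 * real r ^ 2 - 2) / real r ^ 2 * (real r / (2 * (real r - 1))) = 1 + 1 / real r"
      using r by (simp add: field_simps power2_eq_square)
    then show ?thesis
      using r2 unfolding nn_integral_N_loc by (subst ennreal_mult'[symmetric]) auto
  qed
  ultimately show ?thesis using Takagi_image measurable_N_loc by blast
qed

end
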